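(* Let $f,g:[0,\infty)\to[0,\infty)$ be two measurable (capacity) functions with $m(f)<\infty$ and $m(g)<\infty$. Then $$\operatorname{cov}\big(S_o(f),S_o(g)\big)\ \ge\ m(f\cdot g).$$ In particular, $\operatorname{var}(S_o(f))\ge m(f^2)$.
   Context: Base stations: $\Pi_B=\{y_0,y_1,\dots\}$ is a homogeneous Poisson point process on $\mathbb{R}^2$ of intensity $\lambda_B>0$. Users: $\Pi_M=\{x_0,x_1,\dots\}$ is a homogeneous Poisson point process on $\mathbb{R}^2$ of intensity $\lambda_M>0$, independent of $\Pi_B$. Path loss: $L:\mathbb{R}^2\to(0,\infty)$ is a measurable function (values on a Lebesgue-null set are irrelevant). Fading: $H$ is a nonnegative random variable with probability density function $p_H$ and complementary cumulative distribution function $F_H(\beta)=P(H\ge\beta)=\int_\beta^\infty p_H(t)\,dt$, assumed to satisfy $F_H(\beta)>0$ for all $\beta$. Define $B(\beta)=\int_{\mathbb{R}^2}F_H\big((L(z)\beta)^{-1}\big)\,dz$ for $\beta>0$; it is assumed that $0<B(\beta)<\infty$ for all $\beta>0$. The typical base station is an additional base station placed at the origin $o$. To each pair $(y,x)$ with $y$ a base station ($y\in\Pi_B\cup\{o\}$) and $x$ a user location is attached a fading variable $h_{yx}$; given $\Pi_B$ and $\Pi_M$, all these variables are independent copies of $H$. Put $s_{yx}=\big(h_{yx}L(y-x)\big)^{-1}$ and let $\xi_0^x=\min_{y\in\Pi_B}s_{yx}$ be the smallest path loss fading at $x$ among the base stations of $\Pi_B$ (not counting $o$). A user $x$ is served by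 $o$ iff $s_{ox}<\xi_0^x$. The cell capacity of the typical base station is $S_o(f)=\sum_{x\in\Pi_M}\mathbf{1}(s_{ox}<\xi_0^x)\,f(s_{ox})$, and $m(f)=E(S_o(f))\in[0,\infty]$. The product $f\cdot g$ is the pointwise product. The covariance is $\operatorname{cov}(S_o(f),S_o(g))=E(S_o(f)S_o(g))-m(f)m(g)$, which may equal $+\infty$, and $\operatorname{var}(S_o(f))=\operatorname{cov}(S_o(f),S_o(f))$. *)

theory Defs
  imports "HOL-Probability.Probability"
begin

text \<open>
  A point process is given by an enumeration \<open>X 0, X 1, \<dots>\<close> of its points; the process itself is
  the random counting measure below, in which repeated points are counted with multiplicity.
\<close>

definition point_count :: "(nat \<Rightarrow> 'w \<Rightarrow> 'a) \<Rightarrow> 'w \<Rightarrow> 'a set \<Rightarrow> ennreal" where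
  "point_count X \<omega> A = emeasure (count_space UNIV) {i. X i \<omega> \<in> A}"

text \<open>
  An enumeration by all of \<open>nat\<close> is no restriction for positive intensity, since such a process
  almost surely has infinitely many points in the plane (and almost surely no repeated ones).
\<close>

definition poisson_process :: "'w measure \<Rightarrow> real \<Rightarrow> (nat \<Rightarrow> 'w \<Rightarrow> real^2) \<Rightarrow> bool" where
  "poisson_process M lam X \<longleftrightarrow>
     (\<forall>i. X i \<in> borel_measurable M) \<and>
     (\<forall>A \<in> sets borel. bounded A \<longrightarrow> (\<forall>k::nat.
        measure M {\<omega> \<in> space M. point_count X \<omega> A = of_nat k} =
          exp (- (lam * measure lborel A)) * (lam * measure lborel A) ^ k / fact k)) \<and>
     (\<forall>(n::nat) A. (\<forall>i<n. A i \<in> sets borel \<and> bounded (A i)) \<longrightarrow> disjoint_family_on A {..<n} \<longrightarrow>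
        prob_space.indep_vars M (\<lambda>_. borel) (\<lambda>i \<omega>. point_count X \<omega> (A i)) {..<n})"

text \<open>
  Independence of the point processes themselves, that is, of their random counting measures; the
  enumerations need not be independent.
\<close>

definition indep_point_processes ::
    "'w measure \<Rightarrow> (nat \<Rightarrow> 'w \<Rightarrow> real^2) \<Rightarrow> (nat \<Rightarrow> 'w \<Rightarrow> real^2) \<Rightarrow> bool" where
  "indep_point_processes M Y X \<longleftrightarrow>
     prob_space.indep_var M
       (\<Pi>\<^sub>M A\<in>sets borel. borel) (\<lambda>\<omega>. \<lambda>A\<in>sets borel. point_count Y \<omega> A)
       (\<Pi>\<^sub>M A\<in>sets borel. borel) (\<lambda>\<omega>. \<lambda>A\<in>sets borel. point_count X \<omega> A)"

definition ccdf :: "'w measure \<Rightarrow> ('w \<Rightarrow> real) \<Rightarrow> real \<Rightarrow> real" where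
  "ccdf M H \<beta> = measure M {\<omega> \<in> space M. H \<omega> \<ge> \<beta>}"

definition B_fun :: "'w measure \<Rightarrow> ('w \<Rightarrow> real) \<Rightarrow> (real^2 \<Rightarrow> real) \<Rightarrow> real \<Rightarrow> ennreal" where
  "B_fun M H L \<beta> = (\<integral>\<^sup>+z. ennreal (ccdf M H (inverse (L z * \<beta>))) \<partial>lborel)"

text \<open>
  Base stations \<open>Y k\<close>, users \<open>X i\<close>. The fading variable of the pair (station, user \<open>i\<close>) is
  \<open>h (Some k) i\<close> for the station \<open>Y k\<close> and \<open>h None i\<close> for the typical station at the origin.
  That the fading variables are, given both point processes, independent copies of \<open>H\<close> is expressed
  by the last three assumptions; the last one is independence of the generated sigma-algebras.
\<close>

locale cellular_network = prob_space M
  for M :: "'w measure" +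
  fixes lamB lamM :: real
    and Y X :: "nat \<Rightarrow> 'w \<Rightarrow> real^2"
    and L :: "real^2 \<Rightarrow> real"
    and H :: "'w \<Rightarrow> real" and p\<^sub>H :: "real \<Rightarrow> real"
    and h :: "nat option \<Rightarrow> nat \<Rightarrow> 'w \<Rightarrow> real"
  assumes intensity_pos: "lamB > 0" "lamM > 0"
    and stations: "poisson_process M lamB Y"
    and users: "poisson_process M lamM X"
    and indep_stations_users: "indep_point_processes M Y X"
    and path_loss_measurable: "L \<in> borel_measurable borel"
    and path_loss_pos: "\<And>z. L z > 0"
    and fading_density: "\<And>t. p\<^sub>H t \<ge> 0" "distributed M lborel H (\<lambda>t. ennreal (p\<^sub>H t))"
    and fading_nonneg: "AE \<omega> in M. H \<omega> \<ge> 0"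
    and fading_ccdf_pos: "\<And>\<beta>. ccdf M H \<beta> > 0"
    and B_pos: "\<And>\<beta>. \<beta> > 0 \<Longrightarrow> B_fun M H L \<beta> > 0"
    and B_finite: "\<And>\<beta>. \<beta> > 0 \<Longrightarrow> B_fun M H L \<beta> < \<infinity>"
    and fading_copies: "\<And>b i. distr M borel (h b i) = distr M borel H"
    and fading_indep: "indep_vars (\<lambda>_. borel) (\<lambda>(b, i). h b i) UNIV"
    and fading_indep_points:
      "indep_set
         (sets (vimage_algebra (space M) (\<lambda>\<omega>. (\<lambda>k. Y k \<omega>, \<lambda>i. X i \<omega>))
           ((\<Pi>\<^sub>M k\<in>UNIV. borel) \<Otimes>\<^sub>M (\<Pi>\<^sub>M i\<in>UNIV. borel))))
         (sets (vimage_algebra (space M) (\<lambda>\<omega> (b, i). h b i \<omega>) (\<Pi>\<^sub>M p\<in>UNIV. borel)))"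

text \<open>
  The values lie in \<open>[0, \<infinity>]\<close>, with value \<open>\<infinity>\<close> for zero fading, which happens with probability 0.
\<close>

definition path_loss_fading :: "(real^2 \<Rightarrow> real) \<Rightarrow> real \<Rightarrow> real^2 \<Rightarrow> ennreal" where
  "path_loss_fading L t z = inverse (ennreal (t * L z))"

definition s_origin :: "(nat \<Rightarrow> 'w \<Rightarrow> real^2) \<Rightarrow> (real^2 \<Rightarrow> real) \<Rightarrow>
    (nat option \<Rightarrow> nat \<Rightarrow> 'w \<Rightarrow> real) \<Rightarrow> nat \<Rightarrow> 'w \<Rightarrow> ennreal" where
  "s_origin X L h i \<omega> = path_loss_fading L (h None i \<omega>) (0 - X i \<omega>)"

text \<open>
  The infimum is almost surely attained: the number of stations with path loss fading at most
  \<open>\<beta>\<close> at a given location is Poisson with finite mean \<open>lamB B(\<beta>)\<close>.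
\<close>

definition xi0 :: "(nat \<Rightarrow> 'w \<Rightarrow> real^2) \<Rightarrow> (nat \<Rightarrow> 'w \<Rightarrow> real^2) \<Rightarrow> (real^2 \<Rightarrow> real) \<Rightarrow>
    (nat option \<Rightarrow> nat \<Rightarrow> 'w \<Rightarrow> real) \<Rightarrow> nat \<Rightarrow> 'w \<Rightarrow> ennreal" where
  "xi0 Y X L h i \<omega> = (INF k. path_loss_fading L (h (Some k) i \<omega>) (Y k \<omega> - X i \<omega>))"

definition cell_capacity :: "(nat \<Rightarrow> 'w \<Rightarrow> real^2) \<Rightarrow> (nat \<Rightarrow> 'w \<Rightarrow> real^2) \<Rightarrow> (real^2 \<Rightarrow> real) \<Rightarrow>
    (nat option \<Rightarrow> nat \<Rightarrow> 'w \<Rightarrow> real) \<Rightarrow> (real \<Rightarrow> real) \<Rightarrow> 'w \<Rightarrow> ennreal" where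
  "cell_capacity Y X L h f \<omega> =
     (\<Sum>i. if s_origin X L h i \<omega> < xi0 Y X L h i \<omega>
          then ennreal (f (enn2real (s_origin X L h i \<omega>))) else 0)"

definition mean_capacity :: "'w measure \<Rightarrow> (nat \<Rightarrow> 'w \<Rightarrow> real^2) \<Rightarrow> (nat \<Rightarrow> 'w \<Rightarrow> real^2) \<Rightarrow>
    (real^2 \<Rightarrow> real) \<Rightarrow> (nat option \<Rightarrow> nat \<Rightarrow> 'w \<Rightarrow> real) \<Rightarrow> (real \<Rightarrow> real) \<Rightarrow> ennreal" where
  "mean_capacity M Y X L h f = (\<integral>\<^sup>+\<omega>. cell_capacity Y X L h f \<omega> \<partial>M)"

text \<open>
  Meaningful for nonnegative variables with finite means; the value may be \<open>\<infinity>\<close>.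
\<close>

definition ext_cov :: "'w measure \<Rightarrow> ('w \<Rightarrow> ennreal) \<Rightarrow> ('w \<Rightarrow> ennreal) \<Rightarrow> ereal" where
  "ext_cov M U V = enn2ereal (\<integral>\<^sup>+\<omega>. U \<omega> * V \<omega> \<partial>M)
     - enn2ereal (\<integral>\<^sup>+\<omega>. U \<omega> \<partial>M) * enn2ereal (\<integral>\<^sup>+\<omega>. V \<omega> \<partial>M)"

definition ext_var :: "'w measure \<Rightarrow> ('w \<Rightarrow> ennreal) \<Rightarrow> ereal" where
  "ext_var M U = ext_cov M U U"

end

theory Submission
  imports Defs
begin

text \<open>
  Write \<open>S(f)\<close> for the cell capacity. In the product \<open>S(f) S(g)\<close>, a double sum over users, the diagonal
  terms add up to \<open>S(f g)\<close>, because one user contributes \<open>f(s) g(s)\<close>. The theorem therefore says that the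
  pairs of distinct users contribute at least \<open>m(f) m(g)\<close> in the mean, which is a statement of positive
  correlation: two users see the same base stations, and a configuration of stations that is favourable
  to one location tends to be favourable to every other.

  Given both point processes, distinct users have independent fading. The conditional mean of the
  contribution of a pair is thus \<open>u(f, x, Y) u(g, x', Y)\<close>, where \<open>x\<close> and \<open>x'\<close> are the locations of the two
  users and \<open>u(f, x, Y)\<close>, called \<open>mean_user_capacity\<close> below, is the mean capacity of one user
  (\<open>nn_integral_capacity_at_two_users\<close>). The function \<open>u\<close> depends on the stations only through their
  counting measure, and that measure is independent of the one of the users. So the Campbell formulas
  for the users (\<open>campbell\<close>, \<open>campbell_off_diagonal\<close>) turn \<open>m(f)\<close> into the integral of \<open>E u(f, x, Y)\<close> over
  the plane, and the sum over pairs of distinct users into the double integral of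
  \<open>E (u(f, x, Y) u(g, x', Y))\<close>, both with respect to the intensity of the users. What remains is
  \<open>E (u(f, x, Y) u(g, x', Y)) \<ge> E u(f, x, Y) E u(g, x', Y)\<close> for fixed locations
  (\<open>mean_user_capacity_positively_correlated\<close>).

  This is an instance of the Harris inequality: an additional station can only lower \<open>u\<close>. A direct proof
  is possible because \<open>u\<close> is a mixture of limits of products over the stations: given the path loss
  fading \<open>s\<close> from the origin, the user is served if every station independently has a larger value. A
  product of numbers in \<open>[0, 1]\<close> over the stations is \<open>exp(-T)\<close> with \<open>T\<close> a sum over the stations. If the
  summand is a step function with bounded cells, \<open>T\<close> is a nonnegative linear combination of the
  independent counts of the cells, so two such exponentials factorise over the cells, and in each cell
  two decreasing functions of the same count are positively correlated. Monotone approximation by step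
  functions yields the general case (\<open>expneg_point_sums_positively_correlated\<close>).
\<close>

section \<open>The function exp(-x) on the extended half-line\<close>

definition expneg :: "ennreal \<Rightarrow> ennreal" where
  "expneg x = (if x = \<infinity> then 0 else ennreal (exp (- enn2real x)))"

text \<open>
  Inverse of \<open>expneg\<close> on \<open>[0, 1]\<close>. It rewrites a product of probabilities over the points of a process as
  a sum over the points. The value \<open>\<infinity>\<close> at 0 allows for factors that vanish.
\<close>

definition neglog :: "ennreal \<Rightarrow> ennreal" where
  "neglog a = (if a = 0 then \<infinity> else ennreal (- ln (enn2real a)))"

lemma expneg_measurable [measurable]: "expneg \<in> borel_measurable borel"
  unfolding expneg_def by measurable

lemma neglog_measurable [measurable]: "neglog \<in> borel_measurable borel"
  unfolding neglog_def by measurable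

lemma expneg_neglog:
  assumes "a \<le> 1"
  shows "expneg (neglog a) = a"
proof (cases a)
  case (real r)
  then show ?thesis using assms by (cases "r = 0") (auto simp: expneg_def neglog_def)
next
  case top
  then show ?thesis using assms by (simp add: top_unique)
qed

lemma expneg_le_1: "expneg x \<le> 1"
  by (simp add: expneg_def)

lemma expneg_0 [simp]: "expneg 0 = 1"
  by (simp add: expneg_def)

lemma expneg_add: "expneg (x + y) = expneg x * expneg y"
proof (cases x; cases y)
  fix r s assume "0 \<le> r" "x = ennreal r" "0 \<le> s" "y = ennreal s"
  then show ?thesis
    by (simp add: expneg_def exp_add exp_diff exp_minus divide_inverse
        flip: ennreal_plus ennreal_mult)
qed (simp_all add: expneg_def)

lemma expneg_sum: "finite I \<Longrightarrow> expneg (\<Sum>i\<in>I. x i) = (\<Prod>i\<in>I. expneg (x i))"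
  by (induction I rule: finite_induct) (auto simp: expneg_add)

lemma expneg_antimono: "x \<le> y \<Longrightarrow> expneg y \<le> expneg x"
  by (cases x; cases y) (auto simp: expneg_def top_unique)

lemma neglog_antimono:
  assumes "a \<le> b"
  shows "neglog b \<le> neglog a"
proof (cases b)
  case (real r)
  then obtain r' where "a = ennreal r'" "r' \<ge> 0" using assms by (cases a) (auto simp: top_unique)
  then show ?thesis
    using assms real by (auto simp: neglog_def intro!: ennreal_leI ln_mono)
qed (simp add: neglog_def)

text \<open>
  This bound gives the continuity of \<open>expneg\<close> at \<open>\<infinity>\<close>, where the formula by the real exponential breaks down.
\<close>

lemma expneg_le_inverse: "expneg x \<le> inverse x"
proof (cases x)
  case (real r)
  show ?thesis
  proof (cases "r = 0")
    case False
    then have "r > 0" using real by simp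
    have "exp (- r) \<le> inverse r"
      unfolding exp_minus using \<open>r > 0\<close> exp_ge_add_one_self[of r] by (intro le_imp_inverse_le) linarith+
    then show ?thesis using real \<open>r > 0\<close> by (simp add: expneg_def inverse_ennreal)
  qed (use real in simp)
qed (simp add: expneg_def)

lemma tendsto_expneg:
  assumes "x \<longlonglongrightarrow> l"
  shows "(\<lambda>n. expneg (x n)) \<longlonglongrightarrow> expneg l"
proof (cases l)
  case (real r)
  have "(\<lambda>n. ennreal (exp (- enn2real (x n)))) \<longlonglongrightarrow> ennreal (exp (- enn2real l))"
    using assms real by (intro tendsto_ennrealI tendsto_exp tendsto_minus tendsto_enn2real) auto
  moreover have "\<forall>\<^sub>F n in sequentially. x n < \<top>"
    using assms real by (intro order_tendstoD) auto
  then have "\<forall>\<^sub>F n in sequentially. ennreal (exp (- enn2real (x n))) = expneg (x n)"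
    by eventually_elim (simp add: expneg_def)
  ultimately have "(\<lambda>n. expneg (x n)) \<longlonglongrightarrow> ennreal (exp (- enn2real l))"
    by (rule Lim_transform_eventually)
  then show ?thesis
    using real by (simp add: expneg_def)
next
  case top
  have "(\<lambda>n. inverse (x n)) \<longlonglongrightarrow> inverse l"
    using assms continuous_on_inverse_ennreal[OF continuous_on_id]
    by (auto simp: continuous_on_def intro: tendsto_compose[of inverse])
  then have "(\<lambda>n. expneg (x n)) \<longlonglongrightarrow> 0"
    using top by (intro tendsto_sandwich[OF _ _ tendsto_const, of 0 "\<lambda>n. expneg (x n)" _ "\<lambda>n. inverse (x n)"])
      (auto simp: expneg_le_inverse)
  then show ?thesis using top by (simp add: expneg_def)
qed

section \<open>Sums over the points of a process\<close>

lemma suminf_eq_nn_integral: "(\<Sum>k. c k) = (\<integral>\<^sup>+ k. c k \<partial>count_space UNIV)" for c :: "nat \<Rightarrow> ennreal"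
  by (simp add: nn_integral_count_space_nat)

lemma suminf_suminf_off_diagonal:
  fixes c :: "nat \<Rightarrow> nat \<Rightarrow> ennreal"
  shows "(\<Sum>i. \<Sum>j. c i j) = (\<integral>\<^sup>+p. c (fst p) (snd p) \<partial>count_space {(i, j). i \<noteq> j}) + (\<Sum>i. c i i)"
proof -
  have "(\<integral>\<^sup>+p. c (fst p) (snd p) \<partial>count_space {(i, j). i \<noteq> j})
      = (\<integral>\<^sup>+p. c (fst p) (snd p) * indicator {(i, j). i \<noteq> j} p \<partial>count_space UNIV)"
    by (simp add: nn_integral_count_space_indicator)
  also have "\<dots> = (\<Sum>i. \<Sum>j. c i j * indicator {(i, j). i \<noteq> j} (i, j))"
    unfolding suminf_eq_nn_integral by (subst nn_integral_fst_count_space[symmetric]) simp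
  finally have off: "(\<integral>\<^sup>+p. c (fst p) (snd p) \<partial>count_space {(i, j). i \<noteq> j})
      = (\<Sum>i. \<Sum>j. c i j * indicator {(i, j). i \<noteq> j} (i, j))" .
  \<comment> \<open>As a sum over all \<open>j\<close>, the diagonal term can be added under both sums.\<close>
  have diag: "c i i = (\<Sum>j. c i j * indicator {i} j)" for i
    unfolding suminf_eq_nn_integral by (subst nn_integral_count_space_indicator[symmetric]) (auto simp: nn_integral_count_space_finite)
  have "(\<Sum>i. \<Sum>j. c i j * indicator {(i, j). i \<noteq> j} (i, j)) + (\<Sum>i. c i i)
      = (\<Sum>i. (\<Sum>j. c i j * indicator {(i, j). i \<noteq> j} (i, j)) + (\<Sum>j. c i j * indicator {i} j))"
    unfolding diag[symmetric] by (rule suminf_add) (rule summableI)+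
  also have "\<dots> = (\<Sum>i. \<Sum>j. c i j * indicator {(i, j). i \<noteq> j} (i, j) + c i j * indicator {i} j)"
    by (intro suminf_cong suminf_add) (rule summableI)+
  also have "\<dots> = (\<Sum>i. \<Sum>j. c i j)"
    by (intro suminf_cong) (auto split: split_indicator)
  finally show ?thesis unfolding off by simp
qed

lemma point_count_eq_suminf: "point_count X \<omega> A = (\<Sum>k. indicator A (X k \<omega>))"
proof -
  have "point_count X \<omega> A = (\<integral>\<^sup>+ k. indicator {i. X i \<omega> \<in> A} k \<partial>count_space UNIV)"
    unfolding point_count_def by (subst nn_integral_indicator) auto
  then show ?thesis
    by (simp add: suminf_eq_nn_integral indicator_def)
qed

definition locally_finite_on :: "'w set \<Rightarrow> (nat \<Rightarrow> 'w \<Rightarrow> 'a::real_normed_vector) \<Rightarrow> 'w set" where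
  "locally_finite_on \<Omega> X = {\<omega> \<in> \<Omega>. \<forall>n::nat. point_count X \<omega> (ball 0 (real n)) < \<infinity>}"

lemma indicator_eq_SUP_ball:
  "c = (SUP n. c * indicator (ball 0 (real n)) y)" for c :: ennreal and y :: "'a::real_normed_vector"
proof (rule antisym)
  obtain n where "norm y < real n" using reals_Archimedean2 by blast
  then show "c \<le> (SUP n. c * indicator (ball 0 (real n)) y)"
    by (intro SUP_upper2[of n]) auto
qed (auto intro!: SUP_least split: split_indicator)

text \<open>
  Sums over the points are functions of the counts alone, even jointly with a parameter \<open>p\<close>: the
  enumeration of the points does not matter. This is what makes the independence of the two counting
  measures applicable to functionals that are written in terms of enumerations. For indicators of
  rectangles the sum is a count. The class of sets for which the claim holds is closed under complements
  only where differences of sums are finite, whence the restriction to locally finite configurations and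
  the cut-off by balls in the proof.
\<close>

lemma measurable_point_sum:
  fixes Y :: "nat \<Rightarrow> 'w \<Rightarrow> 'a::real_normed_vector" and \<phi> :: "'b \<times> 'a \<Rightarrow> ennreal"
  assumes counts: "\<And>A. A \<in> sets borel \<Longrightarrow> (\<lambda>\<omega>. point_count Y \<omega> A) \<in> borel_measurable S"
    and \<phi>: "\<phi> \<in> borel_measurable (P \<Otimes>\<^sub>M borel)"
  shows "(\<lambda>(p, \<omega>). indicator (locally_finite_on (space S) Y) \<omega> * (\<Sum>k. \<phi> (p, Y k \<omega>)))
    \<in> borel_measurable (P \<Otimes>\<^sub>M S)"
proof -
  define \<Omega> where "\<Omega> = locally_finite_on (space S) Y"
  have count_ball [measurable]: "(\<lambda>\<omega>. point_count Y \<omega> (B \<inter> ball 0 (real n))) \<in> borel_measurable S"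
    if "B \<in> sets borel" for B n
    by (rule counts) (use that in auto)
  have [measurable]: "(\<lambda>\<omega>. point_count Y \<omega> (ball 0 (real n))) \<in> borel_measurable S" for n
    by (rule counts) auto
  have \<Omega> [measurable]: "\<Omega> \<in> sets S"
    unfolding \<Omega>_def locally_finite_on_def by measurable
  define F where "F C n = (\<lambda>(p, \<omega>). indicator \<Omega> \<omega> *
      (\<integral>\<^sup>+ k. indicator C (p, Y k \<omega>) * indicator (ball 0 (real n)) (Y k \<omega>) \<partial>count_space UNIV))"
    for C :: "('b \<times> 'a) set" and n :: nat
  have F_rect: "F (A \<times> B) n (p, \<omega>) = indicator A p * (indicator \<Omega> \<omega> * point_count Y \<omega> (B \<inter> ball 0 (real n)))"
    for A B n p \<omega>
    by (auto simp: F_def point_count_eq_suminf suminf_eq_nn_integral indicator_times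
        indicator_inter_arith nn_integral_cmult split: split_indicator
        intro!: nn_integral_cong)
  have F_meas: "F C n \<in> borel_measurable (P \<Otimes>\<^sub>M S)" if "C \<in> sets (P \<Otimes>\<^sub>M borel)" for C n
    using Int_stable_pair_measure_generator pair_measure_closed that[unfolded sets_pair_measure]
  proof (induction rule: sigma_sets_induct_disjoint)
    case (basic C)
    then obtain A B where C: "C = A \<times> B" "A \<in> sets P" "B \<in> sets borel" by auto
    then have "F C n = (\<lambda>(p, \<omega>). indicator A p * (indicator \<Omega> \<omega> * point_count Y \<omega> (B \<inter> ball 0 (real n))))"
      by (auto simp: fun_eq_iff F_rect)
    with C show ?case by simp
  next
    case empty
    then show ?case by (simp add: F_def)
  next
    case (compl C)
    \<comment> \<open>Finiteness lets the sum over the complement be a difference.\<close>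
    have fin: "F C n (p, \<omega>) < \<infinity>" for p \<omega>
    proof (cases "\<omega> \<in> \<Omega>")
      case True
      have "F C n (p, \<omega>) \<le> F (UNIV \<times> UNIV) n (p, \<omega>)"
        by (auto simp: F_def intro!: mult_left_mono nn_integral_mono split: split_indicator)
      also have "\<dots> < \<infinity>"
        using True unfolding F_rect by (auto simp: \<Omega>_def locally_finite_on_def)
      finally show ?thesis .
    qed (simp add: F_def)
    have "F (space P \<times> space borel - C) n (p, \<omega>) = F (space P \<times> space borel) n (p, \<omega>) - F C n (p, \<omega>)"
      for p \<omega>
    proof -
      have "C \<subseteq> space P \<times> space borel"
        using compl sets.sets_into_space[of C "P \<Otimes>\<^sub>M borel"]
        by (simp add: sets_pair_measure space_pair_measure)
      then have "F (space P \<times> space borel) n (p, \<omega>) = F (space P \<times> space borel - C) n (p, \<omega>) + F C n (p, \<omega>)"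
        unfolding F_def prod.case distrib_left[symmetric]
        by (subst nn_integral_add[symmetric])
           (auto intro!: arg_cong2[where f="(*)"] nn_integral_cong split: split_indicator)
      then show ?thesis using fin[of p \<omega>] by simp
    qed
    then have "F (space P \<times> space borel - C) n = (\<lambda>x. F (space P \<times> space borel) n x - F C n x)"
      by auto
    moreover have "F (space P \<times> space borel) n \<in> borel_measurable (P \<Otimes>\<^sub>M S)"
    proof -
      have "F (space P \<times> space borel) n =
          (\<lambda>(p, \<omega>). indicator (space P) p * (indicator \<Omega> \<omega> * point_count Y \<omega> (space borel \<inter> ball 0 (real n))))"
        by (auto simp: fun_eq_iff F_rect)
      also have "\<dots> \<in> borel_measurable (P \<Otimes>\<^sub>M S)" by measurable
      finally show ?thesis .
    qed
    ultimately show ?case using compl by simp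
  next
    case (union C)
    have "F (\<Union>i. C i) n (p, \<omega>) = (\<Sum>i. F (C i) n (p, \<omega>))" for p \<omega>
    proof -
      have "indicator (\<Union>i. C i) x = (\<Sum>i. indicator (C i) x :: ennreal)" for x
        using union(1) by (rule suminf_indicator[symmetric])
      then show ?thesis
        unfolding F_def prod.case by (simp add: nn_integral_suminf flip: ennreal_suminf_multc)
    qed
    then have "F (\<Union>i. C i) n = (\<lambda>x. \<Sum>i. F (C i) n x)" by auto
    with union show ?case by simp
  qed
  have ind: "(\<lambda>(p, \<omega>). indicator \<Omega> \<omega> * (\<integral>\<^sup>+ k. indicator C (p, Y k \<omega>) \<partial>count_space UNIV))
      \<in> borel_measurable (P \<Otimes>\<^sub>M S)" if C: "C \<in> sets (P \<Otimes>\<^sub>M borel)" for C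
  proof -
    have "(\<integral>\<^sup>+ k. indicator C (p, Y k \<omega>) \<partial>count_space UNIV) =
        (SUP n. \<integral>\<^sup>+ k. indicator C (p, Y k \<omega>) * indicator (ball 0 (real n)) (Y k \<omega>) \<partial>count_space UNIV)" for p \<omega>
      by (subst nn_integral_monotone_convergence_SUP[symmetric])
         (auto simp: incseq_def le_fun_def split: split_indicator simp flip: indicator_eq_SUP_ball)
    then have "(\<lambda>(p, \<omega>). indicator \<Omega> \<omega> * (\<integral>\<^sup>+ k. indicator C (p, Y k \<omega>) \<partial>count_space UNIV))
        = (\<lambda>x. SUP n. F C n x)"
      by (auto simp: F_def fun_eq_iff SUP_mult_left_ennreal)
    also have "\<dots> \<in> borel_measurable (P \<Otimes>\<^sub>M S)"
      using F_meas[OF C] by measurable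
    finally show ?thesis .
  qed
  from \<phi> have "(\<lambda>(p, \<omega>). indicator \<Omega> \<omega> * (\<integral>\<^sup>+ k. \<phi> (p, Y k \<omega>) \<partial>count_space UNIV))
      \<in> borel_measurable (P \<Otimes>\<^sub>M S)"
  proof (induction rule: borel_measurable_induct)
    case (cong f g)
    then have "(\<lambda>(p, \<omega>). indicator \<Omega> \<omega> * (\<integral>\<^sup>+ k. f (p, Y k \<omega>) \<partial>count_space UNIV)) \<in> borel_measurable (P \<Otimes>\<^sub>M S) \<longleftrightarrow>
       (\<lambda>(p, \<omega>). indicator \<Omega> \<omega> * (\<integral>\<^sup>+ k. g (p, Y k \<omega>) \<partial>count_space UNIV)) \<in> borel_measurable (P \<Otimes>\<^sub>M S)"
      by (intro measurable_cong) (auto simp: space_pair_measure intro!: arg_cong2[where f="(*)"] nn_integral_cong)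
    with cong show ?case by simp
  next
    case (set A)
    then show ?case by (rule ind)
  next
    case (mult u c)
    have "(\<lambda>(p, \<omega>). indicator \<Omega> \<omega> * (\<integral>\<^sup>+ k. c * u (p, Y k \<omega>) \<partial>count_space UNIV)) =
       (\<lambda>x. c * (case x of (p, \<omega>) \<Rightarrow> indicator \<Omega> \<omega> * (\<integral>\<^sup>+ k. u (p, Y k \<omega>) \<partial>count_space UNIV)))"
      by (auto simp: fun_eq_iff nn_integral_cmult mult_ac)
    with mult show ?case by simp
  next
    case (add u v)
    have "(\<lambda>(p, \<omega>). indicator \<Omega> \<omega> * (\<integral>\<^sup>+ k. v (p, Y k \<omega>) + u (p, Y k \<omega>) \<partial>count_space UNIV)) =
       (\<lambda>x. (case x of (p, \<omega>) \<Rightarrow> indicator \<Omega> \<omega> * (\<integral>\<^sup>+ k. v (p, Y k \<omega>) \<partial>count_space UNIV)) +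
            (case x of (p, \<omega>) \<Rightarrow> indicator \<Omega> \<omega> * (\<integral>\<^sup>+ k. u (p, Y k \<omega>) \<partial>count_space UNIV)))"
      by (auto simp: fun_eq_iff nn_integral_add distrib_left)
    with add show ?case by simp
  next
    case (seq U)
    have "(\<lambda>(p, \<omega>). indicator \<Omega> \<omega> * (\<integral>\<^sup>+ k. (SUP i. U i) (p, Y k \<omega>) \<partial>count_space UNIV)) =
       (\<lambda>x. SUP i. (case x of (p, \<omega>) \<Rightarrow> indicator \<Omega> \<omega> * (\<integral>\<^sup>+ k. U i (p, Y k \<omega>) \<partial>count_space UNIV)))"
    proof -
      have "(\<integral>\<^sup>+ k. (SUP i. U i) (p, Y k \<omega>) \<partial>count_space UNIV) = (SUP i. \<integral>\<^sup>+ k. U i (p, Y k \<omega>) \<partial>count_space UNIV)"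
        for p \<omega>
        unfolding SUP_apply
        by (rule nn_integral_monotone_convergence_SUP) (use \<open>incseq U\<close> in \<open>auto simp: incseq_def le_fun_def\<close>)
      then show ?thesis by (auto simp: fun_eq_iff SUP_mult_left_ennreal)
    qed
    with seq show ?case by simp
  qed
  then show ?thesis by (simp add: \<Omega>_def suminf_eq_nn_integral)
qed

section \<open>Positive correlation for processes with independent counts\<close>

text \<open>
  Chebyshev's association inequality. For two independent copies of \<open>N\<close> the differences of the values of
  \<open>u\<close> and of \<open>v\<close> have the same sign; integrating the resulting rearrangement inequality over both
  copies gives the claim, twice. Sums in place of differences keep the argument within \<open>[0, \<infinity>]\<close>.
\<close>

lemma (in prob_space) antimono_positively_correlated:
  fixes N :: "'a \<Rightarrow> 'c::linorder" and u v :: "'c \<Rightarrow> ennreal"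
  assumes "antimono u" "antimono v"
    and [measurable]: "(\<lambda>\<omega>. u (N \<omega>)) \<in> borel_measurable M" "(\<lambda>\<omega>. v (N \<omega>)) \<in> borel_measurable M"
  shows "(\<integral>\<^sup>+\<omega>. u (N \<omega>) \<partial>M) * (\<integral>\<^sup>+\<omega>. v (N \<omega>) \<partial>M) \<le> (\<integral>\<^sup>+\<omega>. u (N \<omega>) * v (N \<omega>) \<partial>M)"
proof -
  have ordered: "u a * v b + u b * v a \<le> u a * v a + u b * v b" if ab: "a \<le> b" for a b
  proof -
    obtain x y where x: "u a = u b + x" and y: "v a = v b + y"
      using antimonoD[OF assms(1) ab] antimonoD[OF assms(2) ab]
      by (auto simp: le_iff_add)
    have "u a * v a + u b * v b = (u a * v b + u b * v a) + x * y"
      unfolding x y by (simp add: algebra_simps)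
    then show ?thesis by simp
  qed
  have rearrange: "u a * v b + u b * v a \<le> u a * v a + u b * v b" for a b
    using ordered[of a b] ordered[of b a] by (cases "a \<le> b") (auto simp: add.commute)
  let ?u = "\<integral>\<^sup>+\<omega>. u (N \<omega>) \<partial>M" and ?v = "\<integral>\<^sup>+\<omega>. v (N \<omega>) \<partial>M" and ?uv = "\<integral>\<^sup>+\<omega>. u (N \<omega>) * v (N \<omega>) \<partial>M"
  have "(\<integral>\<^sup>+\<omega>. \<integral>\<^sup>+\<omega>'. u (N \<omega>) * v (N \<omega>') + u (N \<omega>') * v (N \<omega>) \<partial>M \<partial>M)
      \<le> (\<integral>\<^sup>+\<omega>. \<integral>\<^sup>+\<omega>'. u (N \<omega>) * v (N \<omega>) + u (N \<omega>') * v (N \<omega>') \<partial>M \<partial>M)"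
    by (intro nn_integral_mono rearrange)
  then have "?u * ?v + ?u * ?v \<le> ?uv + ?uv"
    by (simp add: nn_integral_add nn_integral_cmult nn_integral_multc emeasure_space_1)
  then show ?thesis
    by (cases "?u * ?v"; cases ?uv) (auto simp: top_unique simp flip: ennreal_plus)
qed

lemma (in prob_space) antimono_indep_positively_correlated:
  fixes N :: "'i \<Rightarrow> 'a \<Rightarrow> ennreal" and u v :: "'i \<Rightarrow> ennreal \<Rightarrow> ennreal"
  assumes "finite I" and indep: "indep_vars (\<lambda>_. borel) N I"
    and "\<And>i. antimono (u i)" "\<And>i. antimono (v i)"
    and [measurable]: "\<And>i. u i \<in> borel_measurable borel" "\<And>i. v i \<in> borel_measurable borel"
  shows "(\<integral>\<^sup>+\<omega>. (\<Prod>i\<in>I. u i (N i \<omega>)) \<partial>M) * (\<integral>\<^sup>+\<omega>. (\<Prod>i\<in>I. v i (N i \<omega>)) \<partial>M)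
    \<le> (\<integral>\<^sup>+\<omega>. (\<Prod>i\<in>I. u i (N i \<omega>)) * (\<Prod>i\<in>I. v i (N i \<omega>)) \<partial>M)"
proof -
  have N: "N i \<in> borel_measurable M" if "i \<in> I" for i
    using indep that by (auto simp: indep_vars_def)
  have split: "(\<integral>\<^sup>+\<omega>. (\<Prod>i\<in>I. w i (N i \<omega>)) \<partial>M) = (\<Prod>i\<in>I. \<integral>\<^sup>+\<omega>. w i (N i \<omega>) \<partial>M)"
    if "\<And>i. w i \<in> borel_measurable borel" for w :: "'i \<Rightarrow> ennreal \<Rightarrow> ennreal"
    by (intro indep_vars_nn_integral \<open>finite I\<close> indep_vars_compose2[OF indep]) (auto simp: that)
  have "(\<integral>\<^sup>+\<omega>. (\<Prod>i\<in>I. u i (N i \<omega>)) \<partial>M) * (\<integral>\<^sup>+\<omega>. (\<Prod>i\<in>I. v i (N i \<omega>)) \<partial>M)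
      = (\<Prod>i\<in>I. (\<integral>\<^sup>+\<omega>. u i (N i \<omega>) \<partial>M) * (\<integral>\<^sup>+\<omega>. v i (N i \<omega>) \<partial>M))"
    by (simp add: split prod.distrib)
  also have "\<dots> \<le> (\<Prod>i\<in>I. \<integral>\<^sup>+\<omega>. u i (N i \<omega>) * v i (N i \<omega>) \<partial>M)"
    using N assms(3,4) by (intro prod_mono_ennreal antimono_positively_correlated) auto
  also have "\<dots> = (\<integral>\<^sup>+\<omega>. (\<Prod>i\<in>I. u i (N i \<omega>) * v i (N i \<omega>)) \<partial>M)"
    by (rule split[symmetric]) simp
  finally show ?thesis by (simp add: prod.distrib)
qed

definition (in prob_space) indep_counts :: "(nat \<Rightarrow> 'a \<Rightarrow> 'c::real_normed_vector) \<Rightarrow> bool" where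
  "indep_counts Y \<longleftrightarrow> (\<forall>(n::nat) A. (\<forall>i<n. A i \<in> sets borel \<and> bounded (A i)) \<longrightarrow>
     disjoint_family_on A {..<n} \<longrightarrow> indep_vars (\<lambda>_. borel) (\<lambda>i \<omega>. point_count Y \<omega> (A i)) {..<n})"

text \<open>
  A common refinement: two functions with finite ranges are constant on the same finitely many cells, so
  that both sums over the points are linear combinations of the same family of counts.
\<close>

lemma simple_function_pair_cells:
  fixes \<phi> \<psi> :: "'c \<Rightarrow> ennreal" and D :: "'c set"
  assumes "finite (range \<phi>)" "finite (range \<psi>)"
  obtains n :: nat and c d :: "nat \<Rightarrow> ennreal" and A :: "nat \<Rightarrow> 'c set"
  where "disjoint_family_on A {..<n}" "\<And>i. A i = {y. \<phi> y = c i \<and> \<psi> y = d i} \<inter> D"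
    "\<And>y. \<phi> y * indicator D y = (\<Sum>i<n. c i * indicator (A i) y)"
    "\<And>y. \<psi> y * indicator D y = (\<Sum>i<n. d i * indicator (A i) y)"
proof -
  let ?R = "range (\<lambda>y. (\<phi> y, \<psi> y))"
  have "finite ?R"
    by (rule finite_subset[of _ "range \<phi> \<times> range \<psi>"]) (use assms in auto)
  then obtain e where e: "bij_betw e {..<card ?R} ?R"
    using ex_bij_betw_nat_finite[of ?R] by (auto simp: atLeast0LessThan)
  define A where "A i = {y. \<phi> y = fst (e i) \<and> \<psi> y = snd (e i)} \<inter> D" for i
  have disj: "disjoint_family_on A {..<card ?R}"
    using e by (auto simp: disjoint_family_on_def A_def bij_betw_def inj_on_def prod_eq_iff)
  have decomp: "\<theta> y * indicator D y = (\<Sum>i<card ?R. p (e i) * indicator (A i) y)"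
    if p: "\<And>y. \<theta> y = p (\<phi> y, \<psi> y)" for \<theta> :: "'c \<Rightarrow> ennreal" and p y
  proof -
    have "(\<phi> y, \<psi> y) \<in> e ` {..<card ?R}"
      using bij_betw_imp_surj_on[OF e] by simp
    then obtain j where j: "j < card ?R" "e j = (\<phi> y, \<psi> y)"
      by auto
    have "y \<in> A i \<longleftrightarrow> i = j \<and> y \<in> D" if "i < card ?R" for i
      using inj_onD[OF bij_betw_imp_inj_on[OF e], of i j] j that by (auto simp: A_def prod_eq_iff)
    then have "(\<Sum>i<card ?R. p (e i) * indicator (A i) y) = (\<Sum>i<card ?R. if i = j then p (e i) * indicator D y else 0)"
      by (intro sum.cong) (auto split: split_indicator)
    then show ?thesis using j p by simp
  qed
  show thesis
    by (rule that[OF disj, of "fst \<circ> e" "snd \<circ> e"])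
       (use decomp[of \<phi> fst] decomp[of \<psi> snd] in \<open>auto simp: A_def\<close>)
qed

text \<open>
  The Harris inequality for functionals of product form. Simple functions that vanish outside a ball
  reduce it to independent counts of bounded cells, and dominated convergence applies because
  \<open>expneg\<close> is bounded by 1.
\<close>

lemma (in prob_space) expneg_point_sums_positively_correlated:
  fixes Y :: "nat \<Rightarrow> 'a \<Rightarrow> 'c::real_normed_vector" and \<phi> \<psi> :: "'c \<Rightarrow> ennreal"
  assumes Y [measurable]: "\<And>k. Y k \<in> borel_measurable M"
    and counts: "indep_counts Y"
    and \<phi> [measurable]: "\<phi> \<in> borel_measurable borel" and \<psi> [measurable]: "\<psi> \<in> borel_measurable borel"
  shows "(\<integral>\<^sup>+\<omega>. expneg (\<Sum>k. \<phi> (Y k \<omega>)) \<partial>M) * (\<integral>\<^sup>+\<omega>. expneg (\<Sum>k. \<psi> (Y k \<omega>)) \<partial>M)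
    \<le> (\<integral>\<^sup>+\<omega>. expneg (\<Sum>k. \<phi> (Y k \<omega>)) * expneg (\<Sum>k. \<psi> (Y k \<omega>)) \<partial>M)"
proof -
  obtain \<Phi> where \<Phi>: "\<And>n. simple_function borel (\<Phi> n)" "incseq \<Phi>" "\<And>x. (SUP n. \<Phi> n x) = \<phi> x"
    using borel_measurable_implies_simple_function_sequence'[OF \<phi>] by metis
  obtain \<Psi> where \<Psi>: "\<And>n. simple_function borel (\<Psi> n)" "incseq \<Psi>" "\<And>x. (SUP n. \<Psi> n x) = \<psi> x"
    using borel_measurable_implies_simple_function_sequence'[OF \<psi>] by metis
  define S where "S \<Theta> n \<omega> = (\<Sum>k. \<Theta> n (Y k \<omega>) * indicator (ball 0 (real n)) (Y k \<omega>))"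
    for \<Theta> :: "nat \<Rightarrow> 'c \<Rightarrow> ennreal" and n \<omega>
  have meas: "\<Phi> n \<in> borel_measurable borel" "\<Psi> n \<in> borel_measurable borel" for n
    using \<Phi> \<Psi> borel_measurable_simple_function by blast+
  have "S \<Theta> n \<in> borel_measurable M" if "\<Theta> n \<in> borel_measurable borel" for \<Theta> n
  proof -
    have "(\<lambda>y. \<Theta> n y * indicator (ball 0 (real n)) y) \<in> borel_measurable borel"
      using that borel_open[OF open_ball[of 0 "real n"], measurable] by measurable
    from measurable_compose[OF Y this] show ?thesis
      unfolding S_def by (rule borel_measurable_suminf_order)
  qed
  then have [measurable]: "S \<Phi> n \<in> borel_measurable M" "S \<Psi> n \<in> borel_measurable M" for n
    using meas by blast+
  have step: "(\<integral>\<^sup>+\<omega>. expneg (S \<Phi> n \<omega>) \<partial>M) * (\<integral>\<^sup>+\<omega>. expneg (S \<Psi> n \<omega>) \<partial>M)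
      \<le> (\<integral>\<^sup>+\<omega>. expneg (S \<Phi> n \<omega>) * expneg (S \<Psi> n \<omega>) \<partial>M)" for n
  proof -
    have fin: "finite (range (\<Phi> n))" "finite (range (\<Psi> n))"
      using simple_functionD(1)[OF \<Phi>(1)[of n]] simple_functionD(1)[OF \<Psi>(1)[of n]] by simp_all
    show ?thesis
    proof (rule simple_function_pair_cells[OF fin, of "ball 0 (real n)"])
      fix m :: nat and c d :: "nat \<Rightarrow> ennreal" and A
      assume disj: "disjoint_family_on A {..<m}"
        and A: "\<And>i. A i = {y. \<Phi> n y = c i \<and> \<Psi> n y = d i} \<inter> ball 0 (real n)"
        and c: "\<And>y. \<Phi> n y * indicator (ball 0 (real n)) y = (\<Sum>i<m. c i * indicator (A i) y)"
        and d: "\<And>y. \<Psi> n y * indicator (ball 0 (real n)) y = (\<Sum>i<m. d i * indicator (A i) y)"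
      have A_borel: "A i \<in> sets borel" for i
        unfolding A using meas[measurable] by measurable
      have "indep_vars (\<lambda>_. borel) (\<lambda>i \<omega>. point_count Y \<omega> (A i)) {..<m}"
      proof (rule counts[unfolded indep_counts_def, rule_format, OF _ disj])
        fix i assume "i < m"
        show "A i \<in> sets borel \<and> bounded (A i)"
          using A_borel[of i] bounded_subset[OF bounded_ball[of 0 "real n"], of "A i"] by (auto simp: A)
      qed
      note corr = antimono_indep_positively_correlated[OF finite_lessThan this,
          of "\<lambda>i x. expneg (c i * x)" "\<lambda>i x. expneg (d i * x)"]
      have sum: "(\<Sum>k. \<Sum>i<m. a i * indicator (A i) (Y k \<omega>)) = (\<Sum>i<m. a i * point_count Y \<omega> (A i))"
        for a :: "nat \<Rightarrow> ennreal" and \<omega>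
        unfolding suminf_eq_nn_integral point_count_eq_suminf
        by (subst nn_integral_sum) (simp_all add: nn_integral_cmult)
      show ?thesis
        using corr unfolding S_def c d sum
        by (simp add: expneg_sum antimono_def expneg_antimono mult_left_mono)
    qed
  qed
  have lim: "(\<lambda>n. S \<Theta> n \<omega>) \<longlonglongrightarrow> (\<Sum>k. \<theta> (Y k \<omega>))"
    if "incseq \<Theta>" "\<And>x. (SUP n. \<Theta> n x) = \<theta> x" for \<Theta> \<theta> \<omega>
  proof -
    let ?f = "\<lambda>n k. \<Theta> n (Y k \<omega>) * indicator (ball 0 (real n)) (Y k \<omega>)"
    have inc: "incseq ?f"
      using that(1) by (auto simp: incseq_def le_fun_def intro!: mult_mono split: split_indicator)
    have "(SUP n. ?f n k) = \<theta> (Y k \<omega>)" for k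
    proof (rule antisym)
      show "(SUP n. ?f n k) \<le> \<theta> (Y k \<omega>)"
        unfolding that(2)[symmetric] by (auto intro!: SUP_mono split: split_indicator)
      obtain m where m: "norm (Y k \<omega>) < real m" using reals_Archimedean2 by blast
      have "\<Theta> n (Y k \<omega>) \<le> ?f (max n m) k" for n
        using m that(1) by (auto simp: incseq_def le_fun_def indicator_def)
      then show "\<theta> (Y k \<omega>) \<le> (SUP n. ?f n k)"
        unfolding that(2)[symmetric] by (intro SUP_least) (rule SUP_upper2, auto)
    qed
    then have "(SUP n. S \<Theta> n \<omega>) = (\<Sum>k. \<theta> (Y k \<omega>))"
      unfolding S_def suminf_eq_nn_integral
      by (subst nn_integral_monotone_convergence_SUP[symmetric, OF inc]) auto
    moreover have "incseq (\<lambda>n. S \<Theta> n \<omega>)"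
      unfolding S_def suminf_eq_nn_integral using inc
      by (auto simp: incseq_def le_fun_def intro!: nn_integral_mono)
    ultimately show ?thesis using LIMSEQ_SUP by metis
  qed
  have lim_expneg: "(\<lambda>n. expneg (S \<Phi> n \<omega>)) \<longlonglongrightarrow> expneg (\<Sum>k. \<phi> (Y k \<omega>))"
       "(\<lambda>n. expneg (S \<Psi> n \<omega>)) \<longlonglongrightarrow> expneg (\<Sum>k. \<psi> (Y k \<omega>))" for \<omega>
    by (intro tendsto_expneg lim \<Phi> \<Psi>)+
  have not_top: "expneg x \<noteq> \<top>" for x
    using expneg_le_1[of x] by (auto simp: top_unique)
  have integral_not_top: "(\<integral>\<^sup>+\<omega>. expneg (Z \<omega>) \<partial>M) \<noteq> \<top>" for Z
    using nn_integral_mono[of M "\<lambda>\<omega>. expneg (Z \<omega>)" "\<lambda>_. 1"]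
    by (auto simp: expneg_le_1 emeasure_space_1 top_unique)
  have lim_integral: "(\<lambda>n. \<integral>\<^sup>+\<omega>. W n \<omega> \<partial>M) \<longlonglongrightarrow> (\<integral>\<^sup>+\<omega>. W' \<omega> \<partial>M)"
    if "\<And>n. W n \<in> borel_measurable M" "W' \<in> borel_measurable M" "\<And>n \<omega>. W n \<omega> \<le> 1"
      "\<And>\<omega>. (\<lambda>n. W n \<omega>) \<longlonglongrightarrow> W' \<omega>" for W :: "nat \<Rightarrow> 'a \<Rightarrow> ennreal" and W'
    using that by (intro nn_integral_dominated_convergence[where w="\<lambda>_. 1"]) (simp_all add: emeasure_space_1)
  have lim_prod: "(\<lambda>n. expneg (S \<Phi> n \<omega>) * expneg (S \<Psi> n \<omega>))
      \<longlonglongrightarrow> expneg (\<Sum>k. \<phi> (Y k \<omega>)) * expneg (\<Sum>k. \<psi> (Y k \<omega>))" for \<omega>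
    by (rule tendsto_mult_ennreal[OF lim_expneg]) (simp add: not_top)
  have "(\<lambda>n. (\<integral>\<^sup>+\<omega>. expneg (S \<Phi> n \<omega>) \<partial>M) * (\<integral>\<^sup>+\<omega>. expneg (S \<Psi> n \<omega>) \<partial>M)) \<longlonglongrightarrow>
      (\<integral>\<^sup>+\<omega>. expneg (\<Sum>k. \<phi> (Y k \<omega>)) \<partial>M) * (\<integral>\<^sup>+\<omega>. expneg (\<Sum>k. \<psi> (Y k \<omega>)) \<partial>M)"
    by (rule tendsto_mult_ennreal[OF lim_integral lim_integral])
      (simp_all add: lim_expneg expneg_le_1 integral_not_top)
  moreover have "(\<lambda>n. \<integral>\<^sup>+\<omega>. expneg (S \<Phi> n \<omega>) * expneg (S \<Psi> n \<omega>) \<partial>M) \<longlonglongrightarrow>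
        (\<integral>\<^sup>+\<omega>. expneg (\<Sum>k. \<phi> (Y k \<omega>)) * expneg (\<Sum>k. \<psi> (Y k \<omega>)) \<partial>M)"
    by (rule lim_integral) (simp_all add: lim_prod expneg_le_1 mult_le_one)
  ultimately show ?thesis
    by (rule LIMSEQ_le) (use step in simp)
qed

section \<open>Integrals over pairs of independent variables\<close>

text \<open>
  A joint law that is a multiple of a product measure on rectangles is that multiple everywhere. The
  measure \<open>Q\<close> may be infinite: below it is a counting measure on indices of points times a probability.
\<close>

lemma nn_integral_pair_law:
  assumes "sigma_finite_measure K1" and K2: "sigma_finite_measure K2"
    and [measurable]: "z \<in> measurable Q K1" "w \<in> measurable Q K2"
    and "c < \<infinity>"
    and law: "\<And>C D. C \<in> sets K1 \<Longrightarrow> D \<in> sets K2 \<Longrightarrow>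
      emeasure Q {q \<in> space Q. z q \<in> C \<and> w q \<in> D} = c * emeasure K1 C * emeasure K2 D"
    and \<phi> [measurable]: "\<phi> \<in> borel_measurable (K1 \<Otimes>\<^sub>M K2)"
  shows "(\<integral>\<^sup>+q. \<phi> (z q, w q) \<partial>Q) = c * (\<integral>\<^sup>+x. \<integral>\<^sup>+y. \<phi> (x, y) \<partial>K2 \<partial>K1)"
proof -
  interpret K1: sigma_finite_measure K1 by fact
  interpret K2: sigma_finite_measure K2 by fact
  have sets1: "sets (density K1 (\<lambda>_. c) \<Otimes>\<^sub>M K2) = sets (K1 \<Otimes>\<^sub>M K2)"
    by (intro sets_pair_measure_cong) auto
  have "density K1 (\<lambda>_. c) \<Otimes>\<^sub>M K2 = distr Q (K1 \<Otimes>\<^sub>M K2) (\<lambda>q. (z q, w q))"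
  proof (rule pair_measure_eqI)
    show "sigma_finite_measure (density K1 (\<lambda>_. c))"
      using \<open>c < \<infinity>\<close> by (subst K1.sigma_finite_iff_density_finite) auto
    show "sets (density K1 (\<lambda>_. c) \<Otimes>\<^sub>M K2) = sets (distr Q (K1 \<Otimes>\<^sub>M K2) (\<lambda>q. (z q, w q)))"
      by (simp add: sets1)
    fix C D assume "C \<in> sets (density K1 (\<lambda>_. c))" "D \<in> sets K2"
    then have CD: "C \<in> sets K1" "D \<in> sets K2" by auto
    have "(\<lambda>q. (z q, w q)) -` (C \<times> D) \<inter> space Q = {q \<in> space Q. z q \<in> C \<and> w q \<in> D}" by auto
    then have "emeasure (distr Q (K1 \<Otimes>\<^sub>M K2) (\<lambda>q. (z q, w q))) (C \<times> D) = c * emeasure K1 C * emeasure K2 D"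
      using CD by (simp add: emeasure_distr law)
    then show "emeasure (density K1 (\<lambda>_. c)) C * emeasure K2 D =
        emeasure (distr Q (K1 \<Otimes>\<^sub>M K2) (\<lambda>q. (z q, w q))) (C \<times> D)"
      using CD by (simp add: emeasure_density_const)
  qed (rule K2)
  then have "(\<integral>\<^sup>+q. \<phi> (z q, w q) \<partial>Q) = (\<integral>\<^sup>+x. \<phi> x \<partial>(density K1 (\<lambda>_. c) \<Otimes>\<^sub>M K2))"
    by (simp add: nn_integral_distr)
  also have "\<dots> = (\<integral>\<^sup>+x. \<integral>\<^sup>+y. \<phi> (x, y) \<partial>K2 \<partial>density K1 (\<lambda>_. c))"
    by (rule K2.nn_integral_fst[symmetric]) (simp add: measurable_cong_sets[OF sets1 refl])
  also have "\<dots> = c * (\<integral>\<^sup>+x. \<integral>\<^sup>+y. \<phi> (x, y) \<partial>K2 \<partial>K1)"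
    by (simp add: nn_integral_density nn_integral_cmult)
  finally show ?thesis .
qed

text \<open>
  Independence in the form of decoupling, both integrals being over the original space. In contrast to
  \<open>indep_var\<close>, the sets version allows the two variables to have different types.
\<close>

lemma (in prob_space) nn_integral_indep_set:
  assumes Z [measurable]: "Z \<in> measurable M S" and W [measurable]: "W \<in> measurable M T"
    and indep: "indep_set (sets (vimage_algebra (space M) Z S)) (sets (vimage_algebra (space M) W T))"
    and \<Psi> [measurable]: "\<Psi> \<in> borel_measurable (S \<Otimes>\<^sub>M T)"
  shows "(\<integral>\<^sup>+\<omega>. \<Psi> (Z \<omega>, W \<omega>) \<partial>M) = (\<integral>\<^sup>+\<omega>'. \<integral>\<^sup>+\<omega>. \<Psi> (Z \<omega>', W \<omega>) \<partial>M \<partial>M)"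
proof -
  interpret Z: prob_space "distr M S Z" by (rule prob_space_distr) simp
  interpret W: prob_space "distr M T W" by (rule prob_space_distr) simp
  have "(\<integral>\<^sup>+\<omega>. \<Psi> (Z \<omega>, W \<omega>) \<partial>M) = 1 * (\<integral>\<^sup>+z. \<integral>\<^sup>+w. \<Psi> (z, w) \<partial>distr M T W \<partial>distr M S Z)"
  proof (rule nn_integral_pair_law[OF Z.sigma_finite_measure_axioms W.sigma_finite_measure_axioms])
    fix C D assume "C \<in> sets (distr M S Z)" "D \<in> sets (distr M T W)"
    then have [measurable]: "C \<in> sets S" "D \<in> sets T" by simp_all
    have "{\<omega> \<in> space M. Z \<omega> \<in> C \<and> W \<omega> \<in> D} = (Z -` C \<inter> space M) \<inter> (W -` D \<inter> space M)" by auto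
    moreover have "prob ((Z -` C \<inter> space M) \<inter> (W -` D \<inter> space M)) = prob (Z -` C \<inter> space M) * prob (W -` D \<inter> space M)"
      by (intro indep_setD[OF indep] in_vimage_algebra) simp_all
    ultimately show "emeasure M {\<omega> \<in> space M. Z \<omega> \<in> C \<and> W \<omega> \<in> D}
        = 1 * emeasure (distr M S Z) C * emeasure (distr M T W) D"
      by (simp add: emeasure_distr emeasure_eq_measure ennreal_mult)
  qed simp_all
  also have "\<dots> = (\<integral>\<^sup>+\<omega>'. \<integral>\<^sup>+w. \<Psi> (Z \<omega>', w) \<partial>distr M T W \<partial>M)"
    by (simp add: nn_integral_distr)
  also have "\<dots> = (\<integral>\<^sup>+\<omega>'. \<integral>\<^sup>+\<omega>. \<Psi> (Z \<omega>', W \<omega>) \<partial>M \<partial>M)"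
  proof (rule nn_integral_cong)
    fix \<omega>' assume "\<omega>' \<in> space M"
    then have "Z \<omega>' \<in> space S" using measurable_space[OF Z] by simp
    then have "(\<lambda>w. \<Psi> (Z \<omega>', w)) \<in> borel_measurable T" by simp
    then show "(\<integral>\<^sup>+w. \<Psi> (Z \<omega>', w) \<partial>distr M T W) = (\<integral>\<^sup>+\<omega>. \<Psi> (Z \<omega>', W \<omega>) \<partial>M)"
      by (intro nn_integral_distr) simp_all
  qed
  finally show ?thesis .
qed

lemma (in prob_space) nn_integral_indep_var:
  assumes indep: "indep_var S Z T W" and \<Psi>: "\<Psi> \<in> borel_measurable (S \<Otimes>\<^sub>M T)"
  shows "(\<integral>\<^sup>+\<omega>. \<Psi> (Z \<omega>, W \<omega>) \<partial>M) = (\<integral>\<^sup>+\<omega>'. \<integral>\<^sup>+\<omega>. \<Psi> (Z \<omega>', W \<omega>) \<partial>M \<partial>M)"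
proof -
  have sigma: "sets (vimage_algebra (space M) V N) = sigma_sets (space M) {V -` A \<inter> space M | A. A \<in> sets N}"
    for V and N :: "'z measure"
    unfolding vimage_algebra_def by (subst sets_measure_of) auto
  show ?thesis
    using indep unfolding indep_var_eq sigma[symmetric] by (intro nn_integral_indep_set[of Z S W T \<Psi>] \<Psi>) auto
qed


section \<open>Moments of Poisson counts\<close>

text \<open>
  The Stein identity of the Poisson distribution, by the recursion \<open>(k + 1) p(k + 1) = \<mu> p(k)\<close> for its
  weights. It delivers the first two moments at once. That the weights have total mass 1 entails that
  \<open>N\<close> is almost surely a natural number.
\<close>

lemma (in prob_space) nn_integral_poisson_size_bias:
  fixes N :: "'a \<Rightarrow> ennreal" and G :: "ennreal \<Rightarrow> ennreal"
  assumes [measurable]: "N \<in> borel_measurable M" "G \<in> borel_measurable borel"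
    and "\<mu> \<ge> 0"
    and pois: "\<And>k::nat. measure M {\<omega> \<in> space M. N \<omega> = of_nat k} = exp (- \<mu>) * \<mu> ^ k / fact k"
  shows "(\<integral>\<^sup>+\<omega>. N \<omega> * G (N \<omega>) \<partial>M) = ennreal \<mu> * (\<integral>\<^sup>+\<omega>. G (N \<omega> + 1) \<partial>M)"
proof -
  define p where "p k = exp (- \<mu>) * \<mu> ^ k / fact k" for k :: nat
  let ?A = "\<lambda>k::nat. {\<omega> \<in> space M. N \<omega> = of_nat k}"
  have p_nonneg: "p k \<ge> 0" for k using \<open>\<mu> \<ge> 0\<close> by (simp add: p_def)
  have disj: "disjoint_family ?A"
    by (auto simp: disjoint_family_on_def)
  have emeas: "emeasure M (?A k) = ennreal (p k)" for k
    by (simp add: emeasure_eq_measure pois p_def)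
  have "(\<lambda>k. exp (- \<mu>) * (\<mu> ^ k /\<^sub>R fact k)) sums (exp (- \<mu>) * exp \<mu>)"
    by (intro sums_mult exp_converges)
  then have "p sums 1"
    by (simp add: p_def[abs_def] exp_minus field_simps)
  have "emeasure M (\<Union>k. ?A k) = (\<Sum>k. ennreal (p k))"
    using disj by (subst suminf_emeasure[symmetric]) (auto simp: emeas)
  also have "\<dots> = 1"
    using \<open>p sums 1\<close> p_nonneg by (simp add: suminf_ennreal2 sums_iff)
  finally have "AE \<omega> in M. \<omega> \<in> (\<Union>k. ?A k)"
    by (intro AE_prob_1) (auto simp: measure_def)
  then have integral: "(\<integral>\<^sup>+\<omega>. F (N \<omega>) \<partial>M) = (\<Sum>k. F (of_nat k) * ennreal (p k))"
    if [measurable]: "F \<in> borel_measurable borel" for F :: "ennreal \<Rightarrow> ennreal"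
  proof -
    have "(\<integral>\<^sup>+\<omega>. F (N \<omega>) \<partial>M) = (\<integral>\<^sup>+\<omega>. (\<Sum>k. F (of_nat k) * indicator (?A k) \<omega>) \<partial>M)"
      using \<open>AE \<omega> in M. \<omega> \<in> (\<Union>k. ?A k)\<close>
    proof (intro nn_integral_cong_AE, eventually_elim)
      case (elim \<omega>)
      then obtain k where k: "\<omega> \<in> ?A k" by auto
      show ?case
        using suminf_cmult_indicator[OF disj k, of "\<lambda>k. F (of_nat k)"] k by simp
    qed
    also have "\<dots> = (\<Sum>k. F (of_nat k) * ennreal (p k))"
      by (subst nn_integral_suminf) (simp_all add: nn_integral_cmult_indicator emeas)
    finally show ?thesis .
  qed
  have "of_nat (Suc k) * ennreal (p (Suc k)) = ennreal \<mu> * ennreal (p k)" for k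
  proof -
    have "real (Suc k) * p (Suc k) = \<mu> * p k"
      by (simp add: p_def field_simps del: of_nat_Suc)
    then show ?thesis
      using p_nonneg \<open>\<mu> \<ge> 0\<close> by (metis ennreal_mult ennreal_of_nat_eq_real_of_nat of_nat_0_le_iff)
  qed
  then have shift: "of_nat (Suc k) * G (of_nat (Suc k)) * ennreal (p (Suc k)) =
      ennreal \<mu> * (G (of_nat k + 1) * ennreal (p k))" for k
    by (metis (no_types, opaque_lifting) mult.assoc mult.commute of_nat_Suc add.commute)
  have "(\<integral>\<^sup>+\<omega>. N \<omega> * G (N \<omega>) \<partial>M) = (\<Sum>k. of_nat k * G (of_nat k) * ennreal (p k))"
    by (rule integral) simp
  also have "\<dots> = (\<Sum>k. of_nat (Suc k) * G (of_nat (Suc k)) * ennreal (p (Suc k)))"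
    by (subst suminf_offset[of _ 1]) (simp_all add: summableI)
  also have "\<dots> = ennreal \<mu> * (\<Sum>k. G (of_nat k + 1) * ennreal (p k))"
    unfolding shift by (rule ennreal_suminf_cmult)
  also have "(\<Sum>k. G (of_nat k + 1) * ennreal (p k)) = (\<integral>\<^sup>+\<omega>. G (N \<omega> + 1) \<partial>M)"
    by (rule integral[symmetric]) simp
  finally show ?thesis .
qed

definition intensity_measure :: "real \<Rightarrow> (real^2) measure" where
  "intensity_measure lam = density lborel (\<lambda>_. ennreal lam)"

lemma sets_intensity_measure [measurable_cong, simp]: "sets (intensity_measure lam) = sets borel"
  by (simp add: intensity_measure_def)

lemma space_intensity_measure [simp]: "space (intensity_measure lam) = UNIV"
  by (simp add: intensity_measure_def)

lemma emeasure_intensity_measure: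
  "A \<in> sets borel \<Longrightarrow> emeasure (intensity_measure lam) A = ennreal lam * emeasure lborel A"
  by (simp add: intensity_measure_def emeasure_density_const)

lemma sigma_finite_intensity_measure: "sigma_finite_measure (intensity_measure lam)"
  unfolding intensity_measure_def
  by (subst sigma_finite_measure.sigma_finite_iff_density_finite[OF sigma_finite_lborel]) auto

lemma emeasure_intensity_measure_bounded:
  assumes "A \<in> sets borel" "bounded A" "lam \<ge> 0"
  shows "emeasure (intensity_measure lam) A = ennreal (lam * measure lborel A)"
    "emeasure (intensity_measure lam) A < \<infinity>"
proof -
  have "emeasure lborel A < \<infinity>" using emeasure_bounded_finite[OF assms(2)] by simp
  then have "emeasure lborel A = ennreal (measure lborel A)"
    by (simp add: emeasure_eq_ennreal_measure)
  then show "emeasure (intensity_measure lam) A = ennreal (lam * measure lborel A)"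
    using assms by (simp add: emeasure_intensity_measure ennreal_mult)
  then show "emeasure (intensity_measure lam) A < \<infinity>" by simp
qed

lemma point_count_measurable:
  assumes "\<And>i. X i \<in> borel_measurable M" "A \<in> sets borel"
  shows "(\<lambda>\<omega>. point_count X \<omega> A) \<in> borel_measurable M"
  unfolding point_count_eq_suminf using assms by measurable

lemma point_count_Un:
  "A \<inter> B = {} \<Longrightarrow> point_count X \<omega> (A \<union> B) = point_count X \<omega> A + point_count X \<omega> B"
  unfolding point_count_eq_suminf suminf_eq_nn_integral
  by (subst nn_integral_add[symmetric]) (auto intro!: nn_integral_cong split: split_indicator)

locale poisson_points = prob_space +
  fixes lam :: real and X :: "nat \<Rightarrow> 'a \<Rightarrow> real^2"
  assumes lam_pos: "lam > 0" and poisson: "poisson_process M lam X"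
begin

abbreviation "\<Lambda> \<equiv> intensity_measure lam"

lemma points_measurable [measurable]: "X i \<in> borel_measurable M"
  using poisson by (simp add: poisson_process_def)

lemma count_measurable [measurable]: "A \<in> sets borel \<Longrightarrow> (\<lambda>\<omega>. point_count X \<omega> A) \<in> borel_measurable M"
  by (rule point_count_measurable) auto

lemma indep_counts: "indep_counts X"
  using poisson by (simp add: poisson_process_def indep_counts_def)

lemma count_size_bias:
  assumes [measurable]: "A \<in> sets borel" and "bounded A" "G \<in> borel_measurable borel"
  shows "(\<integral>\<^sup>+\<omega>. point_count X \<omega> A * G (point_count X \<omega> A) \<partial>M)
    = emeasure \<Lambda> A * (\<integral>\<^sup>+\<omega>. G (point_count X \<omega> A + 1) \<partial>M)"
  using assms poisson lam_pos unfolding emeasure_intensity_measure_bounded(1)[OF assms(1,2) less_imp_le[OF lam_pos]]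
  by (intro nn_integral_poisson_size_bias) (auto simp: poisson_process_def)

lemma count_mean:
  assumes "A \<in> sets borel" "bounded A"
  shows "(\<integral>\<^sup>+\<omega>. point_count X \<omega> A \<partial>M) = emeasure \<Lambda> A"
  using count_size_bias[OF assms, of "\<lambda>_. 1"] by (simp add: emeasure_space_1)

lemma count_square_mean:
  assumes "A \<in> sets borel" "bounded A"
  shows "(\<integral>\<^sup>+\<omega>. point_count X \<omega> A * point_count X \<omega> A \<partial>M) = emeasure \<Lambda> A * emeasure \<Lambda> A + emeasure \<Lambda> A"
  using count_size_bias[OF assms, of "\<lambda>x. x"] assms
  by (simp add: nn_integral_add count_mean emeasure_space_1 distrib_left)

lemma count_disjoint_product_mean:
  assumes A: "A \<in> sets borel" "bounded A" and B: "B \<in> sets borel" "bounded B" and "A \<inter> B = {}"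
  shows "(\<integral>\<^sup>+\<omega>. point_count X \<omega> A * point_count X \<omega> B \<partial>M) = emeasure \<Lambda> A * emeasure \<Lambda> B"
proof -
  define C where "C i = (if i = 0 then A else B)" for i :: nat
  have "indep_vars (\<lambda>_. borel) (\<lambda>i \<omega>. point_count X \<omega> (C i)) {..<2::nat}"
    using assms by (intro indep_counts[unfolded indep_counts_def, rule_format])
      (auto simp: C_def disjoint_family_on_def)
  from indep_vars_nn_integral[OF finite_lessThan this] show ?thesis
    using A B by (simp add: numeral_2_eq_2 C_def count_mean)
qed

text \<open>
  The sets may overlap; the counts of the three disjoint parts are independent.
\<close>

lemma count_product_mean:
  assumes A: "A \<in> sets borel" "bounded A" and B: "B \<in> sets borel" "bounded B"
  shows "(\<integral>\<^sup>+\<omega>. point_count X \<omega> A * point_count X \<omega> B \<partial>M)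
    = emeasure \<Lambda> A * emeasure \<Lambda> B + emeasure \<Lambda> (A \<inter> B)"
proof -
  let ?N = "\<lambda>\<omega>. point_count X \<omega>"
  define a b c where "a = A - B" and "b = A \<inter> B" and "c = B - A"
  have [simp]: "a \<in> sets borel" "b \<in> sets borel" "c \<in> sets borel"
      "bounded a" "bounded b" "bounded c" "a \<inter> b = {}" "a \<inter> c = {}" "b \<inter> c = {}"
    using A B by (auto simp: a_def b_def c_def intro: bounded_subset)
  then have [measurable]: "(\<lambda>\<omega>. ?N \<omega> a) \<in> borel_measurable M" "(\<lambda>\<omega>. ?N \<omega> b) \<in> borel_measurable M"
      "(\<lambda>\<omega>. ?N \<omega> c) \<in> borel_measurable M"
    by (auto intro: count_measurable)
  have AB: "A = a \<union> b" "B = b \<union> c" by (auto simp: a_def b_def c_def)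
  have "(\<integral>\<^sup>+\<omega>. ?N \<omega> A * ?N \<omega> B \<partial>M) =
      (\<integral>\<^sup>+\<omega>. ?N \<omega> a * ?N \<omega> b + ?N \<omega> a * ?N \<omega> c + ?N \<omega> b * ?N \<omega> b + ?N \<omega> b * ?N \<omega> c \<partial>M)"
    unfolding AB by (simp add: point_count_Un distrib_left distrib_right add_ac)
  also have "\<dots> = emeasure \<Lambda> a * emeasure \<Lambda> b + emeasure \<Lambda> a * emeasure \<Lambda> c
      + (emeasure \<Lambda> b * emeasure \<Lambda> b + emeasure \<Lambda> b) + emeasure \<Lambda> b * emeasure \<Lambda> c"
    by (subst nn_integral_add, measurable)+ (simp add: count_disjoint_product_mean count_square_mean)
  also have "\<dots> = (emeasure \<Lambda> a + emeasure \<Lambda> b) * (emeasure \<Lambda> b + emeasure \<Lambda> c) + emeasure \<Lambda> b"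
    by (simp add: distrib_left distrib_right add_ac)
  also have "emeasure \<Lambda> a + emeasure \<Lambda> b = emeasure \<Lambda> A"
    unfolding AB by (rule plus_emeasure) auto
  also have "emeasure \<Lambda> b + emeasure \<Lambda> c = emeasure \<Lambda> B"
    unfolding AB by (rule plus_emeasure) auto
  finally show ?thesis by (simp add: b_def)
qed

end

section \<open>Campbell formulas with an independent factor\<close>

text \<open>
  Used to pass from bounded sets, to which the definition of a Poisson process refers, to all Borel sets.
\<close>

lemma emeasure_eq_of_exhaustion:
  assumes "sets \<mu> = sets \<nu>" and K: "\<And>n::nat. K n \<in> sets \<mu>" "incseq K" "(\<Union>n. K n) = UNIV"
    and C: "C \<in> sets \<mu>"
    and eq: "\<And>n. emeasure \<mu> (C \<inter> K n) = emeasure \<nu> (C \<inter> K n)"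
  shows "emeasure \<mu> C = emeasure \<nu> C"
proof -
  have lim: "(SUP n. emeasure \<rho> (C \<inter> K n)) = emeasure \<rho> C" if "sets \<rho> = sets \<mu>" for \<rho>
  proof -
    have "(\<Union>n. C \<inter> K n) = C" using K(3) by blast
    moreover have "incseq (\<lambda>n. C \<inter> K n)" using K(2) by (auto simp: incseq_def)
    ultimately show ?thesis
      using K(1) C that SUP_emeasure_incseq[of "\<lambda>n. C \<inter> K n" \<rho>] by auto
  qed
  show ?thesis using lim[of \<mu>] lim[of \<nu>] assms(1) eq by simp
qed

lemma incseq_balls: "incseq (\<lambda>n. ball (0::'a::real_normed_vector) (real n))"
  and UN_balls: "(\<Union>n. ball (0::'a::real_normed_vector) (real n)) = UNIV"
proof -
  show "(\<Union>n. ball (0::'a) (real n)) = UNIV"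
    using reals_Archimedean2 by (auto simp: set_eq_iff)
qed (auto simp: incseq_def)

text \<open>
  A Poisson process whose counts are independent of a sub-sigma-algebra \<open>S\<close>. The single points of the
  enumeration may depend on \<open>S\<close>, so the Campbell formulas have to be derived from the counts.
\<close>

locale poisson_points_indep = poisson_points +
  fixes S :: "'a measure"
  assumes subalg: "subalgebra M S"
    and indep_counts_S: "\<And>E G. E \<in> sets S \<Longrightarrow> G \<in> borel_measurable (\<Pi>\<^sub>M A\<in>sets borel. borel) \<Longrightarrow>
      (\<integral>\<^sup>+\<omega>. indicator E \<omega> * G (\<lambda>A\<in>sets borel. point_count X \<omega> A) \<partial>M)
        = emeasure M E * (\<integral>\<^sup>+\<omega>. G (\<lambda>A\<in>sets borel. point_count X \<omega> A) \<partial>M)"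
begin

lemma subalg_sets: "E \<in> sets S \<Longrightarrow> E \<in> sets M"
  using subalg by (auto simp: subalgebra_def)

lemma subalg_measurable: "f \<in> measurable S N \<Longrightarrow> f \<in> measurable M N"
  using subalg measurable_from_subalg by blast

lemma subalg_measurable_pair: "f \<in> measurable (K \<Otimes>\<^sub>M S) N \<Longrightarrow> f \<in> measurable (K \<Otimes>\<^sub>M M) N"
proof -
  have id: "(\<lambda>\<omega>. \<omega>) \<in> measurable M S" by (rule subalg_measurable) simp
  have "(\<lambda>x. (fst x, snd x)) \<in> measurable (K \<Otimes>\<^sub>M M) (K \<Otimes>\<^sub>M S)"
    by (intro measurable_Pair measurable_fst measurable_compose[OF measurable_snd id])
  then have "(\<lambda>x. x) \<in> measurable (K \<Otimes>\<^sub>M M) (K \<Otimes>\<^sub>M S)" by simp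
  then show "f \<in> measurable (K \<Otimes>\<^sub>M S) N \<Longrightarrow> f \<in> measurable (K \<Otimes>\<^sub>M M) N"
    by (rule measurable_compose)
qed

abbreviation "R \<equiv> restr_to_subalg M S"

lemma sigma_finite_R: "sigma_finite_measure R"
  using finite_measure_restr_to_subalg[OF subalg finite_measure_axioms]
  by (simp add: finite_measure.axioms(1))

lemma nn_integral_R: "f \<in> borel_measurable S \<Longrightarrow> (\<integral>\<^sup>+\<omega>. f \<omega> \<partial>R) = (\<integral>\<^sup>+\<omega>. f \<omega> \<partial>M)"
  by (rule nn_integral_subalgebra2[OF subalg])

lemma sets_R [measurable_cong]: "sets R = sets S"
  by (rule sets_restr_to_subalg[OF subalg])

lemma id_measurable_R: "(\<lambda>\<omega>. \<omega>) \<in> measurable M R"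
  by (rule subalg_measurable) (simp add: measurable_cong_sets[OF refl sets_R])

lemma count_indicator_mean:
  assumes "E \<in> sets S" "A \<in> sets borel" "bounded A"
  shows "(\<integral>\<^sup>+\<omega>. indicator E \<omega> * point_count X \<omega> A \<partial>M) = emeasure M E * emeasure \<Lambda> A"
proof -
  have "(\<lambda>m. m A) \<in> borel_measurable (\<Pi>\<^sub>M A\<in>sets (borel :: (real^2) measure). (borel :: ennreal measure))"
    using assms by simp
  from indep_counts_S[OF assms(1) this] show ?thesis
    using assms by (simp add: count_mean)
qed

lemma count_product_indicator_mean:
  assumes "E \<in> sets S" "A \<in> sets borel" "bounded A" "B \<in> sets borel" "bounded B"
  shows "(\<integral>\<^sup>+\<omega>. indicator E \<omega> * (point_count X \<omega> A * point_count X \<omega> B) \<partial>M)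
    = emeasure M E * (emeasure \<Lambda> A * emeasure \<Lambda> B + emeasure \<Lambda> (A \<inter> B))"
proof -
  have "(\<lambda>m. m A * m B) \<in> borel_measurable (\<Pi>\<^sub>M A\<in>sets (borel :: (real^2) measure). (borel :: ennreal measure))"
    using assms by simp
  from indep_counts_S[OF assms(1) this] show ?thesis
    using assms by (simp add: count_product_mean)
qed

abbreviation "Q1 \<equiv> count_space (UNIV :: nat set) \<Otimes>\<^sub>M M"

lemma Q1_measurable:
  assumes "\<And>i. f i \<in> measurable M N"
  shows "(\<lambda>q. f (fst q) (snd q)) \<in> measurable Q1 N"
  using assms by (intro measurable_pair_measure_countable1) auto

text \<open>
  For bounded \<open>C\<close> the left-hand side is the mean of the count of \<open>C\<close> on the event \<open>E\<close>; exhaustion by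
  balls extends the formula to all \<open>C\<close>.
\<close>

lemma first_moment_law:
  assumes C: "C \<in> sets borel" and E: "E \<in> sets S"
  shows "emeasure Q1 {q \<in> space Q1. X (fst q) (snd q) \<in> C \<and> snd q \<in> E} = emeasure \<Lambda> C * emeasure M E"
proof -
  define x where "x q = X (fst q) (snd q)" for q
  define \<mu> where "\<mu> = distr (density Q1 (\<lambda>q. indicator E (snd q))) borel x"
  define \<nu> where "\<nu> = density \<Lambda> (\<lambda>_. emeasure M E)"
  have x [measurable]: "x \<in> borel_measurable Q1"
    unfolding x_def by (rule Q1_measurable) simp
  have [measurable]: "E \<in> sets M" using E by (rule subalg_sets)
  have \<mu>: "emeasure \<mu> C = (\<integral>\<^sup>+q. indicator E (snd q) * indicator C (x q) \<partial>Q1)"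
    if [measurable]: "C \<in> sets borel" for C
  proof -
    have "emeasure \<mu> C = emeasure (density Q1 (\<lambda>q. indicator E (snd q))) (x -` C \<inter> space Q1)"
      unfolding \<mu>_def by (subst emeasure_distr) auto
    also have "\<dots> = (\<integral>\<^sup>+q. indicator E (snd q) * indicator (x -` C \<inter> space Q1) q \<partial>Q1)"
      by (rule emeasure_density) simp_all
    also have "\<dots> = (\<integral>\<^sup>+q. indicator E (snd q) * indicator C (x q) \<partial>Q1)"
      by (intro nn_integral_cong) (simp split: split_indicator)
    finally show ?thesis .
  qed
  have "emeasure \<mu> C = emeasure \<nu> C"
  proof (rule emeasure_eq_of_exhaustion[OF _ _ incseq_balls UN_balls])
    fix n
    let ?C = "C \<inter> ball 0 (real n)"
    have C' [measurable]: "?C \<in> sets borel" using C by simp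
    have "bounded ?C" by (meson bounded_ball bounded_Int)
    have "emeasure \<mu> ?C = (\<integral>\<^sup>+q. indicator E (snd q) * indicator ?C (x q) \<partial>Q1)"
      by (rule \<mu>) simp
    also have "\<dots> = (\<integral>\<^sup>+i. \<integral>\<^sup>+\<omega>. indicator E \<omega> * indicator ?C (X i \<omega>) \<partial>M \<partial>count_space UNIV)"
      by (subst nn_integral_fst[symmetric]) (simp_all add: x_def)
    also have "\<dots> = (\<integral>\<^sup>+\<omega>. (\<Sum>i. indicator E \<omega> * indicator ?C (X i \<omega>)) \<partial>M)"
      unfolding nn_integral_count_space_nat by (rule nn_integral_suminf[symmetric]) simp
    also have "\<dots> = (\<integral>\<^sup>+\<omega>. indicator E \<omega> * point_count X \<omega> ?C \<partial>M)"
      by (simp only: ennreal_suminf_cmult point_count_eq_suminf)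
    also have "\<dots> = emeasure M E * emeasure \<Lambda> ?C"
      by (rule count_indicator_mean[OF E C' \<open>bounded ?C\<close>])
    finally show "emeasure \<mu> ?C = emeasure \<nu> ?C"
      by (simp add: \<nu>_def emeasure_density_const)
  qed (use C in \<open>auto simp: \<mu>_def \<nu>_def\<close>)
  then have "(\<integral>\<^sup>+q. indicator E (snd q) * indicator C (x q) \<partial>Q1) = emeasure M E * emeasure \<Lambda> C"
    using C by (simp add: \<mu> \<nu>_def emeasure_density_const)
  also have "(\<integral>\<^sup>+q. indicator E (snd q) * indicator C (x q) \<partial>Q1)
      = (\<integral>\<^sup>+q. indicator {q \<in> space Q1. x q \<in> C \<and> snd q \<in> E} q \<partial>Q1)"
    by (intro nn_integral_cong) (auto split: split_indicator)
  also have "\<dots> = emeasure Q1 {q \<in> space Q1. x q \<in> C \<and> snd q \<in> E}"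
    using C by (intro nn_integral_indicator) simp
  finally show ?thesis by (simp add: x_def mult.commute)
qed

text \<open>
  Campbell's formula for an integrand that may depend on further randomness, provided that the latter is
  independent of the counts: the points are then replaced by their intensity.
\<close>

lemma campbell:
  assumes \<phi> [measurable]: "\<phi> \<in> borel_measurable (borel \<Otimes>\<^sub>M S)"
  shows "(\<Sum>i. \<integral>\<^sup>+\<omega>. \<phi> (X i \<omega>, \<omega>) \<partial>M) = (\<integral>\<^sup>+x. \<integral>\<^sup>+\<omega>. \<phi> (x, \<omega>) \<partial>M \<partial>\<Lambda>)"
proof -
  have \<phi>M [measurable]: "\<phi> \<in> borel_measurable (borel \<Otimes>\<^sub>M M)"
    by (rule subalg_measurable_pair) simp
  have "(\<Sum>i. \<integral>\<^sup>+\<omega>. \<phi> (X i \<omega>, \<omega>) \<partial>M) = (\<integral>\<^sup>+q. \<phi> (X (fst q) (snd q), snd q) \<partial>Q1)"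
    unfolding suminf_eq_nn_integral
    by (subst nn_integral_fst[symmetric]) (auto intro!: Q1_measurable[where f="\<lambda>i \<omega>. \<phi> (X i \<omega>, \<omega>)"])
  also have "\<dots> = 1 * (\<integral>\<^sup>+x. \<integral>\<^sup>+\<omega>. \<phi> (x, \<omega>) \<partial>R \<partial>\<Lambda>)"
  proof (rule nn_integral_pair_law[OF sigma_finite_intensity_measure sigma_finite_R])
    show "(\<lambda>q. X (fst q) (snd q)) \<in> measurable Q1 \<Lambda>"
      by (rule Q1_measurable) (simp add: measurable_cong_sets[OF refl sets_intensity_measure])
    show "snd \<in> measurable Q1 R"
      by (rule measurable_compose[OF measurable_snd id_measurable_R])
    show "\<phi> \<in> borel_measurable (\<Lambda> \<Otimes>\<^sub>M R)"
      using \<phi> sets_R by (simp cong: measurable_cong_sets sets_pair_measure_cong)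
    fix C D assume "C \<in> sets \<Lambda>" "D \<in> sets R"
    then show "emeasure Q1 {q \<in> space Q1. X (fst q) (snd q) \<in> C \<and> snd q \<in> D} = 1 * emeasure \<Lambda> C * emeasure R D"
      by (simp add: first_moment_law sets_R emeasure_restr_to_subalg[OF subalg])
  qed simp
  also have "\<dots> = (\<integral>\<^sup>+x. \<integral>\<^sup>+\<omega>. \<phi> (x, \<omega>) \<partial>M \<partial>\<Lambda>)"
    by (auto intro!: nn_integral_cong nn_integral_R)
  finally show ?thesis .
qed

abbreviation "I2 \<equiv> {(i, j). i \<noteq> j} :: (nat \<times> nat) set"
abbreviation "Q2 \<equiv> count_space I2 \<Otimes>\<^sub>M M"

lemma Q2_measurable:
  assumes "\<And>p. f p \<in> measurable M N"
  shows "(\<lambda>q. f (fst q) (snd q)) \<in> measurable Q2 N"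
  using assms by (intro measurable_pair_measure_countable1) auto

text \<open>
  All pairs of indices together give the product of the two counts, and the pairs \<open>(i, i)\<close> give the count
  of the intersection. Its mean is exactly the term by which the mean of the product of the counts
  exceeds the product of their means, so the off-diagonal pairs see independent points.
\<close>

lemma second_moment_law_bounded:
  assumes A: "A \<in> sets borel" "bounded A" and B: "B \<in> sets borel" "bounded B" and E: "E \<in> sets S"
  shows "(\<integral>\<^sup>+p. \<integral>\<^sup>+\<omega>. indicator E \<omega> * (indicator A (X (fst p) \<omega>) * indicator B (X (snd p) \<omega>)) \<partial>M \<partial>count_space I2)
    = emeasure M E * (emeasure \<Lambda> A * emeasure \<Lambda> B)"
proof -
  have [measurable]: "E \<in> sets M" "A \<in> sets borel" "B \<in> sets borel"
    using E A B by (auto intro: subalg_sets)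
  define c where "c i j = (\<integral>\<^sup>+\<omega>. indicator E \<omega> * (indicator A (X i \<omega>) * indicator B (X j \<omega>)) \<partial>M)" for i j
  have "(\<Sum>i. c i i) = (\<Sum>i. \<integral>\<^sup>+\<omega>. indicator E \<omega> * indicator (A \<inter> B) (X i \<omega>) \<partial>M)"
    unfolding c_def by (intro suminf_cong nn_integral_cong) (auto split: split_indicator)
  also have "\<dots> = (\<integral>\<^sup>+\<omega>. indicator E \<omega> * point_count X \<omega> (A \<inter> B) \<partial>M)"
    unfolding point_count_eq_suminf ennreal_suminf_cmult[symmetric]
    by (rule nn_integral_suminf[symmetric]) simp
  also have "\<dots> = emeasure M E * emeasure \<Lambda> (A \<inter> B)"
    using A B E by (intro count_indicator_mean) (auto intro: bounded_subset)
  finally have diag: "(\<Sum>i. c i i) = emeasure M E * emeasure \<Lambda> (A \<inter> B)" .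
  have "(\<Sum>i. \<Sum>j. c i j) = (\<integral>\<^sup>+\<omega>. (\<Sum>i. \<Sum>j. indicator E \<omega> * (indicator A (X i \<omega>) * indicator B (X j \<omega>))) \<partial>M)"
    unfolding c_def by (subst nn_integral_suminf, simp)+ (rule refl)
  also have "\<dots> = (\<integral>\<^sup>+\<omega>. indicator E \<omega> * (point_count X \<omega> A * point_count X \<omega> B) \<partial>M)"
    by (simp only: ennreal_suminf_cmult ennreal_suminf_multc point_count_eq_suminf)
  also have "\<dots> = emeasure M E * (emeasure \<Lambda> A * emeasure \<Lambda> B) + emeasure M E * emeasure \<Lambda> (A \<inter> B)"
    using A B E by (simp add: count_product_indicator_mean distrib_left)
  finally have "(\<integral>\<^sup>+p. c (fst p) (snd p) \<partial>count_space I2) + emeasure M E * emeasure \<Lambda> (A \<inter> B)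
      = emeasure M E * (emeasure \<Lambda> A * emeasure \<Lambda> B) + emeasure M E * emeasure \<Lambda> (A \<inter> B)"
    by (simp add: suminf_suminf_off_diagonal diag)
  \<comment> \<open>Boundedness makes the diagonal term finite, so that it cancels.\<close>
  moreover have "emeasure M E * emeasure \<Lambda> (A \<inter> B) \<noteq> \<top>"
    using emeasure_intensity_measure_bounded(2)[of "A \<inter> B" lam] A B lam_pos bounded_Int[of A B]
    by (auto simp: ennreal_mult_eq_top_iff emeasure_eq_measure)
  ultimately show ?thesis by (simp add: c_def)
qed

text \<open>
  The law of a pair of points on a fixed event \<open>E\<close>. Rectangles with bounded sides come first, then all
  rectangles by exhaustion, and then all measurable sets of pairs by uniqueness of product measures.
\<close>

lemma second_moment_law:
  assumes E: "E \<in> sets S" and C: "C \<in> sets (\<Lambda> \<Otimes>\<^sub>M \<Lambda>)"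
  shows "emeasure Q2 {q \<in> space Q2. (X (fst (fst q)) (snd q), X (snd (fst q)) (snd q)) \<in> C \<and> snd q \<in> E}
    = emeasure (\<Lambda> \<Otimes>\<^sub>M \<Lambda>) C * emeasure M E"
proof -
  interpret \<Lambda>: sigma_finite_measure \<Lambda> by (rule sigma_finite_intensity_measure)
  define x y where "x q = X (fst (fst q)) (snd q)" and "y q = X (snd (fst q)) (snd q)" for q :: "(nat \<times> nat) \<times> 'a"
  \<comment> \<open>Restricting to \<open>E\<close> by a density makes the law of the pair of points a product up to the factor \<open>P(E)\<close>.\<close>
  define QE where "QE = density Q2 (\<lambda>q. indicator E (snd q))"
  define \<mu> where "\<mu> = distr QE (\<Lambda> \<Otimes>\<^sub>M \<Lambda>) (\<lambda>q. (x q, y q))"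
  define \<nu> where "\<nu> = density (\<Lambda> \<Otimes>\<^sub>M \<Lambda>) (\<lambda>_. emeasure M E)"
  have x [measurable]: "x \<in> borel_measurable Q2"
    unfolding x_def by (rule Q2_measurable[of "\<lambda>p \<omega>. X (fst p) \<omega>"]) simp
  have y [measurable]: "y \<in> borel_measurable Q2"
    unfolding y_def by (rule Q2_measurable[of "\<lambda>p \<omega>. X (snd p) \<omega>"]) simp
  have [measurable]: "E \<in> sets M" using E by (rule subalg_sets)
  have sets_QE [measurable_cong]: "sets QE = sets Q2" and space_QE: "space QE = space Q2"
    by (simp_all add: QE_def)
  have QE: "emeasure QE D = (\<integral>\<^sup>+q. indicator E (snd q) * indicator D q \<partial>Q2)"
    if "D \<in> sets Q2" for D
    unfolding QE_def by (rule emeasure_density) (simp_all add: that)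
  have meas: "{q \<in> space Q2. x q \<in> A \<and> y q \<in> B} \<in> sets Q2"
    if [measurable]: "A \<in> sets borel" "B \<in> sets borel" for A B
    by measurable
  have rect: "emeasure \<mu> (A \<times> B) = emeasure QE {q \<in> space QE. x q \<in> A \<and> y q \<in> B}"
    if "A \<in> sets borel" "B \<in> sets borel" for A B
  proof -
    have "(\<lambda>q. (x q, y q)) -` (A \<times> B) \<inter> space QE = {q \<in> space QE. x q \<in> A \<and> y q \<in> B}" by auto
    then show ?thesis using that unfolding \<mu>_def by (subst emeasure_distr) simp_all
  qed
  have law: "emeasure QE {q \<in> space QE. x q \<in> A \<and> y q \<in> B} = emeasure M E * emeasure \<Lambda> A * emeasure \<Lambda> B"
    if A: "A \<in> sets borel" and B: "B \<in> sets borel" for A B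
  proof -
    have "emeasure \<mu> (A \<times> B) = emeasure \<nu> (A \<times> B)"
    proof (rule emeasure_eq_of_exhaustion)
      fix n
      let ?b = "ball (0::real^2) (real n)"
      show "?b \<times> ?b \<in> sets \<mu>" by (simp add: \<mu>_def)
      have AB' [measurable]: "A \<inter> ?b \<in> sets borel" "B \<inter> ?b \<in> sets borel" using A B by simp_all
      have bdd: "bounded (A \<inter> ?b)" "bounded (B \<inter> ?b)" by (meson bounded_ball bounded_Int)+
      have "(A \<times> B) \<inter> (?b \<times> ?b) = (A \<inter> ?b) \<times> (B \<inter> ?b)" by auto
      then have "emeasure \<mu> ((A \<times> B) \<inter> (?b \<times> ?b)) = emeasure QE {q \<in> space QE. x q \<in> A \<inter> ?b \<and> y q \<in> B \<inter> ?b}"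
        using rect[OF AB'] by simp
      also have "\<dots> = (\<integral>\<^sup>+q. indicator E (snd q) * indicator {q \<in> space QE. x q \<in> A \<inter> ?b \<and> y q \<in> B \<inter> ?b} q \<partial>Q2)"
        unfolding space_QE by (rule QE) (rule meas[OF AB'])
      also have "\<dots> = (\<integral>\<^sup>+q. indicator E (snd q) * (indicator (A \<inter> ?b) (x q) * indicator (B \<inter> ?b) (y q)) \<partial>Q2)"
        by (intro nn_integral_cong) (auto simp: space_QE split: split_indicator)
      also have "\<dots> = (\<integral>\<^sup>+p. \<integral>\<^sup>+\<omega>. indicator E \<omega> * (indicator (A \<inter> ?b) (X (fst p) \<omega>) * indicator (B \<inter> ?b) (X (snd p) \<omega>)) \<partial>M \<partial>count_space I2)"
        by (subst nn_integral_fst[symmetric], measurable) (simp add: x_def y_def)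
      also have "\<dots> = emeasure M E * (emeasure \<Lambda> (A \<inter> ?b) * emeasure \<Lambda> (B \<inter> ?b))"
        by (rule second_moment_law_bounded[OF AB'(1) bdd(1) AB'(2) bdd(2) E])
      also have "\<dots> = emeasure \<nu> ((A \<inter> ?b) \<times> (B \<inter> ?b))"
        by (simp add: \<nu>_def emeasure_density_const \<Lambda>.emeasure_pair_measure_Times)
      also have "(A \<inter> ?b) \<times> (B \<inter> ?b) = (A \<times> B) \<inter> (?b \<times> ?b)" by auto
      finally show "emeasure \<mu> ((A \<times> B) \<inter> (?b \<times> ?b)) = emeasure \<nu> ((A \<times> B) \<inter> (?b \<times> ?b))" .
    next
      show "incseq (\<lambda>n. ball (0::real^2) (real n) \<times> ball (0::real^2) (real n))"
        by (auto simp: incseq_def)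
      have "z \<in> (\<Union>n. ball 0 (real n) \<times> ball 0 (real n))" for z :: "(real^2) \<times> (real^2)"
      proof -
        obtain n where "max (norm (fst z)) (norm (snd z)) < real n" using reals_Archimedean2 by blast
        then show ?thesis by (cases z) auto
      qed
      then show "(\<Union>n. ball (0::real^2) (real n) \<times> ball (0::real^2) (real n)) = UNIV" by blast
    qed (use A B in \<open>simp_all add: \<mu>_def \<nu>_def\<close>)
    then show ?thesis
      using A B by (simp add: rect \<nu>_def emeasure_density_const \<Lambda>.emeasure_pair_measure_Times mult.assoc)
  qed
  have "(\<integral>\<^sup>+q. indicator C (x q, y q) \<partial>QE) = emeasure M E * (\<integral>\<^sup>+a. \<integral>\<^sup>+b. indicator C (a, b) \<partial>\<Lambda> \<partial>\<Lambda>)"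
  proof (rule nn_integral_pair_law[OF sigma_finite_intensity_measure sigma_finite_intensity_measure])
    show "x \<in> measurable QE \<Lambda>" "y \<in> measurable QE \<Lambda>" by simp_all
    show "indicator C \<in> borel_measurable (\<Lambda> \<Otimes>\<^sub>M \<Lambda>)" using C by simp
  qed (use law in \<open>auto simp: emeasure_eq_measure\<close>)
  also have "(\<integral>\<^sup>+a. \<integral>\<^sup>+b. indicator C (a, b) \<partial>\<Lambda> \<partial>\<Lambda>) = emeasure (\<Lambda> \<Otimes>\<^sub>M \<Lambda>) C"
    using C by (subst \<Lambda>.nn_integral_fst) simp_all
  also have "(\<integral>\<^sup>+q. indicator C (x q, y q) \<partial>QE) = (\<integral>\<^sup>+q. indicator E (snd q) * indicator C (x q, y q) \<partial>Q2)"
    unfolding QE_def using C by (intro nn_integral_density) simp_all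
  also have "\<dots> = (\<integral>\<^sup>+q. indicator {q \<in> space Q2. (x q, y q) \<in> C \<and> snd q \<in> E} q \<partial>Q2)"
    by (intro nn_integral_cong) (auto split: split_indicator)
  also have "\<dots> = emeasure Q2 {q \<in> space Q2. (x q, y q) \<in> C \<and> snd q \<in> E}"
    using C by (intro nn_integral_indicator) simp
  finally show ?thesis by (simp add: x_def y_def mult.commute)
qed

lemma campbell_off_diagonal:
  assumes \<phi> [measurable]: "\<phi> \<in> borel_measurable ((borel \<Otimes>\<^sub>M borel) \<Otimes>\<^sub>M S)"
  shows "(\<integral>\<^sup>+p. \<integral>\<^sup>+\<omega>. \<phi> ((X (fst p) \<omega>, X (snd p) \<omega>), \<omega>) \<partial>M \<partial>count_space I2)
    = (\<integral>\<^sup>+x. \<integral>\<^sup>+y. \<integral>\<^sup>+\<omega>. \<phi> ((x, y), \<omega>) \<partial>M \<partial>\<Lambda> \<partial>\<Lambda>)"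
proof -
  interpret \<Lambda>: sigma_finite_measure \<Lambda> by (rule sigma_finite_intensity_measure)
  interpret \<Lambda>\<Lambda>: pair_sigma_finite \<Lambda> \<Lambda> ..
  have \<phi>M [measurable]: "\<phi> \<in> borel_measurable ((borel \<Otimes>\<^sub>M borel) \<Otimes>\<^sub>M M)"
    by (rule subalg_measurable_pair) simp
  let ?z = "\<lambda>p \<omega>. (X (fst p) \<omega>, X (snd p) \<omega>)"
  have "(\<integral>\<^sup>+p. \<integral>\<^sup>+\<omega>. \<phi> (?z p \<omega>, \<omega>) \<partial>M \<partial>count_space I2) = (\<integral>\<^sup>+q. \<phi> (?z (fst q) (snd q), snd q) \<partial>Q2)"
    by (subst nn_integral_fst[symmetric]) (auto intro!: Q2_measurable[where f="\<lambda>p \<omega>. \<phi> (?z p \<omega>, \<omega>)"])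
  also have "\<dots> = 1 * (\<integral>\<^sup>+z. \<integral>\<^sup>+\<omega>. \<phi> (z, \<omega>) \<partial>R \<partial>(\<Lambda> \<Otimes>\<^sub>M \<Lambda>))"
  proof (rule nn_integral_pair_law[OF \<Lambda>\<Lambda>.sigma_finite_measure_axioms sigma_finite_R])
    have "(\<lambda>q. ?z (fst q) (snd q)) \<in> measurable Q2 (borel \<Otimes>\<^sub>M borel)"
      by (rule Q2_measurable) simp
    then show "(\<lambda>q. ?z (fst q) (snd q)) \<in> measurable Q2 (\<Lambda> \<Otimes>\<^sub>M \<Lambda>)"
      by (simp cong: measurable_cong_sets sets_pair_measure_cong)
    show "snd \<in> measurable Q2 R"
      by (rule measurable_compose[OF measurable_snd id_measurable_R])
    show "\<phi> \<in> borel_measurable ((\<Lambda> \<Otimes>\<^sub>M \<Lambda>) \<Otimes>\<^sub>M R)"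
      using \<phi> sets_R by (simp cong: measurable_cong_sets sets_pair_measure_cong)
    fix C D assume "C \<in> sets (\<Lambda> \<Otimes>\<^sub>M \<Lambda>)" "D \<in> sets R"
    then show "emeasure Q2 {q \<in> space Q2. ?z (fst q) (snd q) \<in> C \<and> snd q \<in> D}
        = 1 * emeasure (\<Lambda> \<Otimes>\<^sub>M \<Lambda>) C * emeasure R D"
      by (simp add: second_moment_law sets_R emeasure_restr_to_subalg[OF subalg])
  qed simp
  also have "\<dots> = (\<integral>\<^sup>+z. \<integral>\<^sup>+\<omega>. \<phi> (z, \<omega>) \<partial>M \<partial>(\<Lambda> \<Otimes>\<^sub>M \<Lambda>))"
    by (auto intro!: nn_integral_cong nn_integral_R)
  also have "\<dots> = (\<integral>\<^sup>+x. \<integral>\<^sup>+y. \<integral>\<^sup>+\<omega>. \<phi> ((x, y), \<omega>) \<partial>M \<partial>\<Lambda> \<partial>\<Lambda>)"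
    by (rule \<Lambda>.nn_integral_fst[symmetric]) (simp cong: measurable_cong_sets sets_pair_measure_cong)
  finally show ?thesis .
qed

end

section \<open>Averaging over the fading\<close>

text \<open>
  The value 0 at \<open>\<infinity>\<close>, in place of \<open>f 0\<close>, reflects that a user with infinite path loss fading is never
  served; it makes the factorisation \<open>user_capacity_eq_SUP\<close> exact.
\<close>

definition capacity_at :: "(real \<Rightarrow> real) \<Rightarrow> ennreal \<Rightarrow> ennreal" where
  "capacity_at f s = (if s = \<infinity> then 0 else ennreal (f (enn2real s)))"

text \<open>
  A term of \<open>cell_capacity\<close> as a function of deterministic arguments, so that the fading \<open>e\<close> can be
  averaged while the location \<open>x\<close> of the user and the stations \<open>y\<close> are held fixed.
\<close>

definition user_capacity :: "(real^2 \<Rightarrow> real) \<Rightarrow> (real \<Rightarrow> real) \<Rightarrow> real^2 \<Rightarrow> (nat option \<Rightarrow> real) \<Rightarrow>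
    (nat \<Rightarrow> real^2) \<Rightarrow> ennreal" where
  "user_capacity L f x e y =
     (if path_loss_fading L (e None) (0 - x) < (INF k. path_loss_fading L (e (Some k)) (y k - x))
      then ennreal (f (enn2real (path_loss_fading L (e None) (0 - x)))) else 0)"

lemma cell_capacity_eq:
  "cell_capacity Y X L h f \<omega> = (\<Sum>i. user_capacity L f (X i \<omega>) (\<lambda>b. h b i \<omega>) (\<lambda>k. Y k \<omega>))"
  unfolding cell_capacity_def user_capacity_def s_origin_def xi0_def by (rule refl)

text \<open>
  A strict inequality with an infimum over the stations is not a conjunction over the stations. With a
  gap of \<open>1 / (n + 1)\<close> it is an increasing union of such conjunctions, and the probability of each of
  these is a product over the stations.
\<close>

lemma less_INF_iff_gap:
  fixes s :: ennreal and a :: "nat \<Rightarrow> ennreal"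
  shows "s < (INF k. a k) \<longleftrightarrow> s \<noteq> \<infinity> \<and> (\<exists>n. \<forall>k. s + ennreal (1 / real (Suc n)) \<le> a k)"
proof
  assume less: "s < (INF k. a k)"
  then have "s \<noteq> \<infinity>" by auto
  then obtain r where r: "s = ennreal r" "r \<ge> 0" by (cases s) auto
  have "\<exists>n. s + ennreal (1 / real (Suc n)) \<le> (INF k. a k)"
  proof (cases "INF k. a k")
    case (real r')
    then have "r < r'" using less r by (simp add: ennreal_less_iff)
    then obtain n where "1 / real (Suc n) < r' - r"
      using nat_approx_posE[of "r' - r"] by auto
    then have "s + ennreal (1 / real (Suc n)) \<le> ennreal r'"
      using r by (auto intro!: ennreal_leI simp flip: ennreal_plus)
    then show ?thesis using real by auto
  qed simp
  then show "s \<noteq> \<infinity> \<and> (\<exists>n. \<forall>k. s + ennreal (1 / real (Suc n)) \<le> a k)"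
    using \<open>s \<noteq> \<infinity>\<close> by (auto simp: le_INF_iff)
next
  assume *: "s \<noteq> \<infinity> \<and> (\<exists>n. \<forall>k. s + ennreal (1 / real (Suc n)) \<le> a k)"
  then obtain n where "s + ennreal (1 / real (Suc n)) \<le> (INF k. a k)"
    by (auto simp: le_INF_iff)
  moreover obtain r where "s = ennreal r" "r \<ge> 0" using * by (cases s) auto
  then have "s < s + ennreal (1 / real (Suc n))"
    by (simp add: ennreal_less_iff flip: ennreal_plus)
  ultimately show "s < (INF k. a k)" by (rule less_le_trans[rotated])
qed

lemma user_capacity_eq_SUP:
  "user_capacity L f x e y = capacity_at f (path_loss_fading L (e None) (0 - x)) *
     (SUP n. of_bool (\<forall>k. path_loss_fading L (e None) (0 - x) + ennreal (1 / real (Suc n))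
        \<le> path_loss_fading L (e (Some k)) (y k - x)))"
proof -
  let ?s = "path_loss_fading L (e None) (0 - x)" and ?a = "\<lambda>k. path_loss_fading L (e (Some k)) (y k - x)"
  show ?thesis
  proof (cases "?s < (INF k. ?a k)")
    case True
    then obtain n where n: "?s \<noteq> \<infinity>" "\<forall>k. ?s + ennreal (1 / real (Suc n)) \<le> ?a k"
      unfolding less_INF_iff_gap by blast
    have "(SUP n. of_bool (\<forall>k. ?s + ennreal (1 / real (Suc n)) \<le> ?a k) :: ennreal) = 1"
    proof (rule antisym)
      show "1 \<le> (SUP n. of_bool (\<forall>k. ?s + ennreal (1 / real (Suc n)) \<le> ?a k) :: ennreal)"
        using n(2) by (intro SUP_upper2[of n]) auto
    qed (auto intro!: SUP_least)
    then show ?thesis using True n(1) by (simp add: user_capacity_def capacity_at_def)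
  next
    case False
    then have "?s = \<infinity> \<or> (\<forall>n. \<not> (\<forall>k. ?s + ennreal (1 / real (Suc n)) \<le> ?a k))"
      unfolding less_INF_iff_gap by blast
    then have "capacity_at f ?s = 0 \<or> (SUP n. of_bool (\<forall>k. ?s + ennreal (1 / real (Suc n)) \<le> ?a k) :: ennreal) = 0"
      by (auto simp only: capacity_at_def of_bool_def if_True if_False SUP_const UNIV_not_empty not_False_eq_True simp_thms)
    then show ?thesis using False by (auto simp: user_capacity_def)
  qed
qed

context
  fixes f :: "real \<Rightarrow> real"
  assumes f: "f \<in> borel_measurable (restrict_space borel {0..})"
begin

lemma measurable_capacity_enn2real: "(\<lambda>s. f (enn2real s)) \<in> borel_measurable borel"
proof -
  have "enn2real \<in> measurable borel (restrict_space borel {0..})"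
    by (intro measurable_restrict_space2) auto
  from measurable_compose[OF this f] show ?thesis .
qed

lemma measurable_capacity_at: "capacity_at f \<in> borel_measurable borel"
  unfolding capacity_at_def using measurable_capacity_enn2real[measurable] by measurable

end

lemma measurable_path_loss_fading [measurable (raw)]:
  assumes [measurable]: "L \<in> borel_measurable borel" "t \<in> borel_measurable N" "z \<in> borel_measurable N"
  shows "(\<lambda>n. path_loss_fading L (t n) (z n)) \<in> borel_measurable N"
  unfolding path_loss_fading_def by measurable

lemma measurable_user_capacity:
  assumes [measurable]: "L \<in> borel_measurable borel"
    and f: "f \<in> borel_measurable (restrict_space borel {0..})"
    and [measurable]: "x \<in> borel_measurable N" "\<And>b. (\<lambda>n. e n b) \<in> borel_measurable N"
      "\<And>k. (\<lambda>n. y n k) \<in> borel_measurable N"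
  shows "(\<lambda>n. user_capacity L f (x n) (e n) (y n)) \<in> borel_measurable N"
  unfolding user_capacity_def using measurable_compose[OF _ measurable_capacity_enn2real[OF f], measurable (raw)]
  by measurable

lemma of_bool_mono_ennreal: "(P \<Longrightarrow> Q) \<Longrightarrow> (of_bool P :: ennreal) \<le> of_bool Q"
  by simp

context cellular_network
begin

abbreviation "P\<^sub>H \<equiv> distr M borel H"

lemma fading_measurable: "h b i \<in> borel_measurable M"
  using fading_indep unfolding indep_vars_def by (auto dest!: bspec[of _ _ "(b, i)"])

lemma H_measurable [measurable]: "H \<in> borel_measurable M"
  using fading_density(2) by (auto simp: distributed_def)

lemma prob_space_P\<^sub>H: "prob_space P\<^sub>H"
  by (rule prob_space_distr) simp

lemma nn_integral_fading:
  assumes "F \<in> borel_measurable borel"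
  shows "(\<integral>\<^sup>+\<omega>. F (h b i \<omega>) \<partial>M) = (\<integral>\<^sup>+t. F t \<partial>P\<^sub>H)"
  using assms fading_measurable[of b i] by (subst fading_copies[of b i, symmetric]) (simp add: nn_integral_distr)

text \<open>
  The tail distribution function of the path loss fading at displacement \<open>z\<close>.
\<close>

definition loss_tail :: "ennreal \<Rightarrow> real^2 \<Rightarrow> ennreal" where
  "loss_tail r z = (\<integral>\<^sup>+t. of_bool (r \<le> path_loss_fading L t z) \<partial>P\<^sub>H)"

lemma loss_tail_le_1: "loss_tail r z \<le> 1"
proof -
  interpret P: prob_space P\<^sub>H by (rule prob_space_P\<^sub>H)
  have "loss_tail r z \<le> (\<integral>\<^sup>+t. 1 \<partial>P\<^sub>H)"
    unfolding loss_tail_def by (intro nn_integral_mono) auto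
  then show ?thesis by (simp only: nn_integral_const P.emeasure_space_1 mult_1)
qed

lemma measurable_of_bool_loss:
  assumes [measurable]: "r \<in> borel_measurable N" "t \<in> borel_measurable N" "z \<in> borel_measurable N"
  shows "(\<lambda>n. of_bool (r n \<le> path_loss_fading L (t n) (z n)) :: ennreal) \<in> borel_measurable N"
proof -
  have [measurable]: "L \<in> borel_measurable borel" by (rule path_loss_measurable)
  have "(\<lambda>n. of_bool (r n \<le> path_loss_fading L (t n) (z n)) :: ennreal)
      = (\<lambda>n. if r n \<le> path_loss_fading L (t n) (z n) then 1 else 0)" by auto
  also have "\<dots> \<in> borel_measurable N" by measurable
  finally show ?thesis .
qed

lemma measurable_loss_tail:
  assumes [measurable]: "r \<in> borel_measurable N" "z \<in> borel_measurable N"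
  shows "(\<lambda>n. loss_tail (r n) (z n)) \<in> borel_measurable N"
proof -
  interpret P: prob_space P\<^sub>H by (rule prob_space_P\<^sub>H)
  have "(\<lambda>(n, t). of_bool (r n \<le> path_loss_fading L t (z n)) :: ennreal) \<in> borel_measurable (N \<Otimes>\<^sub>M P\<^sub>H)"
    unfolding split_beta by (rule measurable_of_bool_loss) auto
  from P.borel_measurable_nn_integral[OF this] show ?thesis
    unfolding loss_tail_def .
qed

text \<open>
  By independence of the fading variables the probability for the first \<open>m\<close> stations is a product; both
  sides are limits as \<open>m\<close> tends to infinity.
\<close>

lemma prob_no_station_below:
  "(\<integral>\<^sup>+\<omega>. of_bool (\<forall>k. r \<le> path_loss_fading L (h (Some k) i \<omega>) (z k)) \<partial>M)
    = expneg (\<Sum>k. neglog (loss_tail r (z k)))"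
proof -
  define G where "G k \<omega> = (of_bool (r \<le> path_loss_fading L (h (Some k) i \<omega>) (z k)) :: ennreal)" for k \<omega>
  have G [measurable]: "G k \<in> borel_measurable M" for k
    unfolding G_def using fading_measurable by (intro measurable_of_bool_loss) auto
  have fin: "(\<integral>\<^sup>+\<omega>. (\<Prod>k<m. G k \<omega>) \<partial>M) = expneg (\<Sum>k<m. neglog (loss_tail r (z k)))" for m
  proof -
    define J where "J = (\<lambda>k. (Some k, i)) ` {..<m}"
    define F where "F p t = (of_bool (r \<le> path_loss_fading L t (z (the (fst p)))) :: ennreal)" for t and p :: "nat option \<times> nat"
    have F [measurable]: "F p \<in> borel_measurable borel" for p
      unfolding F_def by (intro measurable_of_bool_loss) auto
    have inj: "inj_on (\<lambda>k. (Some k, i)) {..<m}" by (auto simp: inj_on_def)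
    have "indep_vars (\<lambda>_. borel) (\<lambda>p \<omega>. F p ((case p of (b, i) \<Rightarrow> h b i) \<omega>)) J"
      by (rule indep_vars_compose2[OF indep_vars_subset[OF fading_indep]]) auto
    from indep_vars_nn_integral[OF _ this]
    have "(\<integral>\<^sup>+\<omega>. (\<Prod>p\<in>J. F p ((case p of (b, i) \<Rightarrow> h b i) \<omega>)) \<partial>M)
        = (\<Prod>p\<in>J. \<integral>\<^sup>+\<omega>. F p ((case p of (b, i) \<Rightarrow> h b i) \<omega>) \<partial>M)"
      by (simp add: J_def)
    then have "(\<integral>\<^sup>+\<omega>. (\<Prod>k<m. G k \<omega>) \<partial>M) = (\<Prod>k<m. \<integral>\<^sup>+\<omega>. F (Some k, i) (h (Some k) i \<omega>) \<partial>M)"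
      by (simp add: J_def prod.reindex[OF inj] G_def F_def)
    also have "\<dots> = (\<Prod>k<m. loss_tail r (z k))"
      by (simp only: nn_integral_fading[OF F]) (simp add: loss_tail_def F_def)
    also have "\<dots> = expneg (\<Sum>k<m. neglog (loss_tail r (z k)))"
      by (simp add: expneg_sum expneg_neglog loss_tail_le_1)
    finally show ?thesis .
  qed
  have "(\<lambda>m. \<integral>\<^sup>+\<omega>. (\<Prod>k<m. G k \<omega>) \<partial>M) \<longlonglongrightarrow> (\<integral>\<^sup>+\<omega>. of_bool (\<forall>k. r \<le> path_loss_fading L (h (Some k) i \<omega>) (z k)) \<partial>M)"
  proof (rule nn_integral_dominated_convergence[where w="\<lambda>_. 1"])
    have prod_eq: "(\<Prod>k<m. G k \<omega>) = of_bool (\<forall>k<m. r \<le> path_loss_fading L (h (Some k) i \<omega>) (z k))" for m \<omega>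
      unfolding G_def by (induction m) (auto simp: less_Suc_eq)
    show "AE \<omega> in M. (\<lambda>m. \<Prod>k<m. G k \<omega>) \<longlonglongrightarrow> of_bool (\<forall>k. r \<le> path_loss_fading L (h (Some k) i \<omega>) (z k))"
    proof (intro AE_I2)
      fix \<omega>
      have "\<forall>\<^sub>F m in sequentially. (\<Prod>k<m. G k \<omega>) = of_bool (\<forall>k. r \<le> path_loss_fading L (h (Some k) i \<omega>) (z k))"
      proof (cases "\<forall>k. r \<le> path_loss_fading L (h (Some k) i \<omega>) (z k)")
        case False
        then obtain k where k: "\<not> r \<le> path_loss_fading L (h (Some k) i \<omega>) (z k)" by blast
        show ?thesis
          using eventually_gt_at_top[of k] by eventually_elim (use k False in \<open>auto simp: prod_eq\<close>)
      qed (simp add: prod_eq)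
      then show "(\<lambda>m. \<Prod>k<m. G k \<omega>) \<longlonglongrightarrow> of_bool (\<forall>k. r \<le> path_loss_fading L (h (Some k) i \<omega>) (z k))"
        by (rule tendsto_eventually)
    qed
    show "AE \<omega> in M. (\<Prod>k<m. G k \<omega>) \<le> 1" for m by (simp add: prod_eq)
    have "(\<lambda>\<omega>. of_bool (\<forall>k. r \<le> path_loss_fading L (h (Some k) i \<omega>) (z k)) :: ennreal) = (\<lambda>\<omega>. INF k. G k \<omega>)"
    proof (intro ext antisym)
      fix \<omega>
      show "(INF k. G k \<omega>) \<le> of_bool (\<forall>k. r \<le> path_loss_fading L (h (Some k) i \<omega>) (z k))"
      proof (cases "\<forall>k. r \<le> path_loss_fading L (h (Some k) i \<omega>) (z k)")
        case False
        then obtain k where k: "\<not> r \<le> path_loss_fading L (h (Some k) i \<omega>) (z k)" by blast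
        then show ?thesis by (intro INF_lower2[of k]) (auto simp: G_def)
      qed (auto intro!: INF_lower2[of 0] simp: G_def)
    qed (auto intro!: INF_greatest simp: G_def)
    also have "\<dots> \<in> borel_measurable M" by measurable
    finally show "(\<lambda>\<omega>. of_bool (\<forall>k. r \<le> path_loss_fading L (h (Some k) i \<omega>) (z k)) :: ennreal) \<in> borel_measurable M" .
  qed (simp_all add: emeasure_space_1)
  moreover have "(\<lambda>m. expneg (\<Sum>k<m. neglog (loss_tail r (z k)))) \<longlonglongrightarrow> expneg (\<Sum>k. neglog (loss_tail r (z k)))"
    by (intro tendsto_expneg summable_LIMSEQ summableI)
  ultimately show ?thesis
    unfolding fin by (rule LIMSEQ_unique)
qed

text \<open>
  The summand of a station at \<open>y\<close> in the exponent for a user at \<open>x\<close> whose fading variable for the origin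
  is \<open>t\<close>. The pairing of \<open>t\<close> and \<open>x\<close> is the parameter in \<open>measurable_point_sum\<close>.
\<close>

definition loss_tail_exponent :: "nat \<Rightarrow> (real \<times> (real^2)) \<times> (real^2) \<Rightarrow> ennreal" where
  "loss_tail_exponent n = (\<lambda>((t, x), y). neglog (loss_tail
     (path_loss_fading L t (0 - x) + ennreal (1 / real (Suc n))) (y - x)))"

text \<open>
  The mean of \<open>user_capacity\<close> over the fading (\<open>nn_integral_user_capacity\<close>), in the explicit form from
  which both the dependence on the stations through point sums and the positive correlation are read off.
\<close>

definition mean_user_capacity :: "(real \<Rightarrow> real) \<Rightarrow> real^2 \<Rightarrow> (nat \<Rightarrow> real^2) \<Rightarrow> ennreal" where
  "mean_user_capacity f x y = (\<integral>\<^sup>+t. capacity_at f (path_loss_fading L t (0 - x)) *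
     (SUP n. expneg (\<Sum>k. loss_tail_exponent n ((t, x), y k))) \<partial>P\<^sub>H)"

lemma loss_tail_exponent_measurable:
  "loss_tail_exponent n \<in> borel_measurable ((borel \<Otimes>\<^sub>M borel) \<Otimes>\<^sub>M borel)"
proof -
  have [measurable]: "L \<in> borel_measurable borel" by (rule path_loss_measurable)
  have "(\<lambda>q :: (real \<times> (real^2)) \<times> (real^2). loss_tail
     (path_loss_fading L (fst (fst q)) (0 - snd (fst q)) + ennreal (1 / real (Suc n))) (snd q - snd (fst q)))
     \<in> borel_measurable ((borel \<Otimes>\<^sub>M borel) \<Otimes>\<^sub>M borel)"
    by (rule measurable_loss_tail) measurable
  from measurable_compose[OF this neglog_measurable] show ?thesis
    unfolding loss_tail_exponent_def split_beta .
qed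

lemma loss_tail_exponent_antimono:
  assumes "n \<le> m"
  shows "loss_tail_exponent m q \<le> loss_tail_exponent n q"
proof -
  obtain t x y where q: "q = ((t, x), y)" by (metis surj_pair)
  let ?s = "path_loss_fading L t (0 - x)"
  have "1 / real (Suc m) \<le> 1 / real (Suc n)" using assms by (intro divide_left_mono) auto
  then have le: "?s + ennreal (1 / real (Suc m)) \<le> ?s + ennreal (1 / real (Suc n))"
    by (intro add_left_mono ennreal_leI)
  have "loss_tail (?s + ennreal (1 / real (Suc n))) (y - x) \<le> loss_tail (?s + ennreal (1 / real (Suc m))) (y - x)"
    unfolding loss_tail_def by (intro nn_integral_mono of_bool_mono_ennreal) (rule order_trans[OF le])
  then show ?thesis
    unfolding q loss_tail_exponent_def prod.case by (rule neglog_antimono)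
qed

text \<open>
  The fading for the origin is independent of the fading for the stations. Freezing the former at \<open>t\<close>
  leaves the probability that all stations have path loss fading beyond a fixed threshold.
\<close>

lemma nn_integral_user_capacity:
  assumes f: "f \<in> borel_measurable (restrict_space borel {0..})"
  shows "(\<integral>\<^sup>+\<omega>. user_capacity L f x (\<lambda>b. h b i \<omega>) y \<partial>M) = mean_user_capacity f x y"
proof -
  have [measurable]: "L \<in> borel_measurable borel" by (rule path_loss_measurable)
  note [measurable] = measurable_capacity_at[OF f] fading_measurable
  \<comment> \<open>Indices of the fading variables of user \<open>i\<close> for the origin, and for the stations.\<close>
  define A B where "A = {(None :: nat option, i)}" and "B = (\<lambda>k. (Some k, i)) ` (UNIV :: nat set)"
  define s where "s \<omega> = path_loss_fading L (h None i \<omega>) (0 - x)" for \<omega>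
  define e where "e = (\<lambda>(v :: nat option \<times> nat \<Rightarrow> real, w :: nat option \<times> nat \<Rightarrow> real).
    (\<lambda>b. case b of None \<Rightarrow> v (None, i) | Some k \<Rightarrow> w (Some k, i)))"
  have ind: "indep_var (PiM A (\<lambda>_. borel)) (\<lambda>\<omega>. \<lambda>p\<in>A. (case p of (b, i) \<Rightarrow> h b i) \<omega>)
      (PiM B (\<lambda>_. borel)) (\<lambda>\<omega>. \<lambda>p\<in>B. (case p of (b, i) \<Rightarrow> h b i) \<omega>)"
    by (rule indep_var_restrict[OF fading_indep]) (auto simp: A_def B_def)
  have "(\<lambda>q. e q b) \<in> borel_measurable (PiM A (\<lambda>_. borel) \<Otimes>\<^sub>M PiM B (\<lambda>_. borel))" for b
    by (cases b) (auto simp: e_def A_def B_def split_beta)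
  then have "(\<lambda>q. user_capacity L f x (e q) y) \<in> borel_measurable (PiM A (\<lambda>_. borel) \<Otimes>\<^sub>M PiM B (\<lambda>_. borel))"
    by (intro measurable_user_capacity f) auto
  note split = nn_integral_indep_var[OF ind this]
  have e: "e (\<lambda>p\<in>A. (case p of (b, i) \<Rightarrow> h b i) \<omega>', \<lambda>p\<in>B. (case p of (b, i) \<Rightarrow> h b i) \<omega>)
      = (\<lambda>b. case b of None \<Rightarrow> h None i \<omega>' | Some k \<Rightarrow> h (Some k) i \<omega>)" for \<omega>' \<omega>
    by (auto simp: e_def A_def B_def fun_eq_iff split: option.split)
  have e_same: "(\<lambda>b. case b of None \<Rightarrow> h None i \<omega> | Some k \<Rightarrow> h (Some k) i \<omega>) = (\<lambda>b. h b i \<omega>)" for \<omega>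
    by (auto simp: fun_eq_iff split: option.split)
  have inner: "(\<integral>\<^sup>+\<omega>. user_capacity L f x (\<lambda>b. case b of None \<Rightarrow> t | Some k \<Rightarrow> h (Some k) i \<omega>) y \<partial>M)
      = capacity_at f (path_loss_fading L t (0 - x)) *
         (SUP n. expneg (\<Sum>k. loss_tail_exponent n ((t, x), y k)))" for t
  proof -
    define G where "G n \<omega> = (of_bool (\<forall>k. path_loss_fading L t (0 - x) + ennreal (1 / real (Suc n))
        \<le> path_loss_fading L (h (Some k) i \<omega>) (y k - x)) :: ennreal)" for n \<omega>
    have [measurable]: "G n \<in> borel_measurable M" for n
    proof -
      have "{\<omega> \<in> space M. \<forall>k. path_loss_fading L t (0 - x) + ennreal (1 / real (Suc n))
        \<le> path_loss_fading L (h (Some k) i \<omega>) (y k - x)} \<in> sets M" by measurable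
      then show ?thesis unfolding G_def of_bool_def by measurable
    qed
    have "incseq G"
    proof (intro incseq_SucI le_funI)
      fix n \<omega>
      have "ennreal (1 / real (Suc (Suc n))) \<le> ennreal (1 / real (Suc n))"
        by (intro ennreal_leI divide_left_mono) auto
      from order_trans[OF add_left_mono[OF this]] show "G n \<omega> \<le> G (Suc n) \<omega>"
        unfolding G_def by (intro of_bool_mono_ennreal) blast
    qed
    have "(\<integral>\<^sup>+\<omega>. user_capacity L f x (\<lambda>b. case b of None \<Rightarrow> t | Some k \<Rightarrow> h (Some k) i \<omega>) y \<partial>M)
        = (\<integral>\<^sup>+\<omega>. capacity_at f (path_loss_fading L t (0 - x)) * (SUP n. G n \<omega>) \<partial>M)"
      by (simp add: user_capacity_eq_SUP G_def)
    also have "\<dots> = capacity_at f (path_loss_fading L t (0 - x)) * (\<integral>\<^sup>+\<omega>. (SUP n. G n \<omega>) \<partial>M)"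
      by (rule nn_integral_cmult) simp
    also have "(\<integral>\<^sup>+\<omega>. (SUP n. G n \<omega>) \<partial>M) = (SUP n. \<integral>\<^sup>+\<omega>. G n \<omega> \<partial>M)"
      by (rule nn_integral_monotone_convergence_SUP) (use \<open>incseq G\<close> in simp_all)
    also have "\<dots> = (SUP n. expneg (\<Sum>k. loss_tail_exponent n ((t, x), y k)))"
      by (simp only: G_def prob_no_station_below loss_tail_exponent_def prod.case)
    finally show ?thesis .
  qed
  have meas_inner: "(\<lambda>t. capacity_at f (path_loss_fading L t (0 - x)) *
         (SUP n. expneg (\<Sum>k. loss_tail_exponent n ((t, x), y k)))) \<in> borel_measurable borel"
  proof -
    note [measurable] = loss_tail_exponent_measurable
    show ?thesis by measurable
  qed
  have "(\<integral>\<^sup>+\<omega>. user_capacity L f x (\<lambda>b. h b i \<omega>) y \<partial>M)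
      = (\<integral>\<^sup>+\<omega>'. \<integral>\<^sup>+\<omega>. user_capacity L f x (\<lambda>b. case b of None \<Rightarrow> h None i \<omega>' | Some k \<Rightarrow> h (Some k) i \<omega>) y \<partial>M \<partial>M)"
    using split by (simp only: e e_same)
  also have "\<dots> = mean_user_capacity f x y"
    unfolding inner mean_user_capacity_def by (rule nn_integral_fading[OF meas_inner])
  finally show ?thesis .
qed

lemma nn_integral_user_capacity_product:
  assumes f: "f \<in> borel_measurable (restrict_space borel {0..})"
    and g: "g \<in> borel_measurable (restrict_space borel {0..})"
    and "i \<noteq> j"
  shows "(\<integral>\<^sup>+\<omega>. user_capacity L f x (\<lambda>b. h b i \<omega>) y * user_capacity L g x' (\<lambda>b. h b j \<omega>) y \<partial>M)
    = mean_user_capacity f x y * mean_user_capacity g x' y"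
proof -
  have [measurable]: "L \<in> borel_measurable borel" by (rule path_loss_measurable)
  define A where "A i = (UNIV :: nat option set) \<times> {i :: nat}" for i
  define e where "e i v = (\<lambda>b. v (b, i))" for i :: nat and v :: "nat option \<times> nat \<Rightarrow> real"
  let ?h = "\<lambda>i \<omega>. \<lambda>p\<in>A i. (case p of (b, i) \<Rightarrow> h b i) \<omega>"
  have ind: "indep_var (PiM (A i) (\<lambda>_. borel)) (?h i) (PiM (A j) (\<lambda>_. borel)) (?h j)"
    by (rule indep_var_restrict[OF fading_indep]) (use \<open>i \<noteq> j\<close> in \<open>auto simp: A_def\<close>)
  have [measurable]: "(\<lambda>v. user_capacity L f x (e i v) y) \<in> borel_measurable (PiM (A i) (\<lambda>_. borel))"
      "(\<lambda>v. user_capacity L g x' (e j v) y) \<in> borel_measurable (PiM (A j) (\<lambda>_. borel))"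
    by (auto simp: e_def A_def intro!: measurable_user_capacity f g)
  have meas: "(\<lambda>(v, w). user_capacity L f x (e i v) y * user_capacity L g x' (e j w) y)
      \<in> borel_measurable (PiM (A i) (\<lambda>_. borel) \<Otimes>\<^sub>M PiM (A j) (\<lambda>_. borel))"
    by measurable
  have e: "e l (?h l \<omega>) = (\<lambda>b. h b l \<omega>)" for l \<omega>
    by (auto simp: e_def A_def)
  have [measurable]: "(\<lambda>\<omega>. user_capacity L f x (\<lambda>b. h b i \<omega>) y) \<in> borel_measurable M"
      "(\<lambda>\<omega>. user_capacity L g x' (\<lambda>b. h b j \<omega>) y) \<in> borel_measurable M"
    using fading_measurable by (auto intro!: measurable_user_capacity f g)
  have "(\<integral>\<^sup>+\<omega>. user_capacity L f x (\<lambda>b. h b i \<omega>) y * user_capacity L g x' (\<lambda>b. h b j \<omega>) y \<partial>M)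
      = (\<integral>\<^sup>+\<omega>'. \<integral>\<^sup>+\<omega>. user_capacity L f x (\<lambda>b. h b i \<omega>') y * user_capacity L g x' (\<lambda>b. h b j \<omega>) y \<partial>M \<partial>M)"
    using nn_integral_indep_var[OF ind meas] by (simp only: e prod.case)
  also have "\<dots> = mean_user_capacity f x y * mean_user_capacity g x' y"
    by (simp add: nn_integral_cmult nn_integral_multc nn_integral_user_capacity f g)
  finally show ?thesis .
qed

lemma stations_measurable [measurable]: "Y k \<in> borel_measurable M"
  using stations by (simp add: poisson_process_def)

lemma users_measurable [measurable]: "X i \<in> borel_measurable M"
  using users by (simp add: poisson_process_def)

text \<open>
  Conditioning on both enumerations: the fading is averaged with the points held fixed.
\<close>

lemma integrate_out_fading:
  assumes \<Psi>: "(\<lambda>(z, v). \<Psi> (fst z) (snd z) v) \<in>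
      borel_measurable (((\<Pi>\<^sub>M k\<in>UNIV. borel) \<Otimes>\<^sub>M (\<Pi>\<^sub>M i\<in>UNIV. borel)) \<Otimes>\<^sub>M (\<Pi>\<^sub>M p\<in>UNIV. borel))"
  shows "(\<integral>\<^sup>+\<omega>. \<Psi> (\<lambda>k. Y k \<omega>) (\<lambda>i. X i \<omega>) (\<lambda>(b, i). h b i \<omega>) \<partial>M)
    = (\<integral>\<^sup>+\<omega>'. \<integral>\<^sup>+\<omega>. \<Psi> (\<lambda>k. Y k \<omega>') (\<lambda>i. X i \<omega>') (\<lambda>(b, i). h b i \<omega>) \<partial>M \<partial>M)"
proof -
  let ?S = "(\<Pi>\<^sub>M k\<in>(UNIV :: nat set). (borel :: (real^2) measure)) \<Otimes>\<^sub>M (\<Pi>\<^sub>M i\<in>(UNIV :: nat set). (borel :: (real^2) measure))"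
  let ?T = "\<Pi>\<^sub>M p\<in>(UNIV :: (nat option \<times> nat) set). (borel :: real measure)"
  have Z: "(\<lambda>\<omega>. (\<lambda>k. Y k \<omega>, \<lambda>i. X i \<omega>)) \<in> measurable M ?S"
    by (intro measurable_Pair measurable_PiM_single') auto
  have W: "(\<lambda>\<omega> (b, i). h b i \<omega>) \<in> measurable M ?T"
    by (intro measurable_PiM_single') (auto simp: split_beta fading_measurable)
  from nn_integral_indep_set[OF Z W fading_indep_points \<Psi>] show ?thesis by simp
qed

lemma nn_integral_capacity_at_user:
  assumes f: "f \<in> borel_measurable (restrict_space borel {0..})"
  shows "(\<integral>\<^sup>+\<omega>. user_capacity L f (X i \<omega>) (\<lambda>b. h b i \<omega>) (\<lambda>k. Y k \<omega>) \<partial>M)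
    = (\<integral>\<^sup>+\<omega>. mean_user_capacity f (X i \<omega>) (\<lambda>k. Y k \<omega>) \<partial>M)"
proof -
  have [measurable]: "L \<in> borel_measurable borel" by (rule path_loss_measurable)
  have "(\<lambda>(z, v). user_capacity L f (snd z i) (\<lambda>b. v (b, i)) (fst z)) \<in>
      borel_measurable (((\<Pi>\<^sub>M k\<in>(UNIV :: nat set). borel) \<Otimes>\<^sub>M (\<Pi>\<^sub>M i\<in>(UNIV :: nat set). borel)) \<Otimes>\<^sub>M (\<Pi>\<^sub>M p\<in>UNIV. borel))"
    unfolding split_beta by (rule measurable_user_capacity[OF _ f]) measurable
  from integrate_out_fading[OF this] show ?thesis
    by (simp add: nn_integral_user_capacity f)
qed

lemma nn_integral_capacity_at_two_users:
  assumes f: "f \<in> borel_measurable (restrict_space borel {0..})"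
    and g: "g \<in> borel_measurable (restrict_space borel {0..})" and "i \<noteq> j"
  shows "(\<integral>\<^sup>+\<omega>. user_capacity L f (X i \<omega>) (\<lambda>b. h b i \<omega>) (\<lambda>k. Y k \<omega>)
      * user_capacity L g (X j \<omega>) (\<lambda>b. h b j \<omega>) (\<lambda>k. Y k \<omega>) \<partial>M)
    = (\<integral>\<^sup>+\<omega>. mean_user_capacity f (X i \<omega>) (\<lambda>k. Y k \<omega>) * mean_user_capacity g (X j \<omega>) (\<lambda>k. Y k \<omega>) \<partial>M)"
proof -
  have [measurable]: "L \<in> borel_measurable borel" by (rule path_loss_measurable)
  have "(\<lambda>(z, v). user_capacity L f (snd z i) (\<lambda>b. v (b, i)) (fst z) * user_capacity L g (snd z j) (\<lambda>b. v (b, j)) (fst z)) \<in>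
      borel_measurable (((\<Pi>\<^sub>M k\<in>(UNIV :: nat set). borel) \<Otimes>\<^sub>M (\<Pi>\<^sub>M i\<in>(UNIV :: nat set). borel)) \<Otimes>\<^sub>M (\<Pi>\<^sub>M p\<in>UNIV. borel))"
    unfolding split_beta by (intro borel_measurable_times_ennreal measurable_user_capacity f g) measurable
  from integrate_out_fading[OF this] show ?thesis
    by (simp add: nn_integral_user_capacity_product f g \<open>i \<noteq> j\<close>)
qed

end

section \<open>Dependence on the stations\<close>

context cellular_network
begin

lemma stations_poisson_points: "poisson_points M lamB Y"
  by unfold_locales (use intensity_pos stations in auto)

text \<open>
  Generated by the counts only. The enumeration \<open>Y\<close> carries more information, which need not be
  independent of the users.
\<close>

definition station_algebra :: "'w measure" where
  "station_algebra = vimage_algebra (space M) (\<lambda>\<omega>. \<lambda>A\<in>sets borel. point_count Y \<omega> A) (\<Pi>\<^sub>M A\<in>sets borel. borel)"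

lemma space_station_algebra [simp]: "space station_algebra = space M"
  by (simp add: station_algebra_def)

lemma station_counts_measurable:
  assumes "A \<in> sets borel"
  shows "(\<lambda>\<omega>. point_count Y \<omega> A) \<in> borel_measurable station_algebra"
proof -
  have "(\<lambda>\<omega>. \<lambda>A\<in>sets borel. point_count Y \<omega> A) \<in> measurable station_algebra (\<Pi>\<^sub>M A\<in>sets borel. borel)"
    unfolding station_algebra_def by (rule measurable_vimage_algebra1) (auto simp: space_PiM)
  from measurable_compose[OF this measurable_component_singleton[OF assms]] show ?thesis
    using assms by simp
qed

lemma users_poisson_points_indep: "poisson_points_indep M lamM X station_algebra"
proof -
  let ?N = "\<Pi>\<^sub>M A\<in>sets (borel :: (real^2) measure). (borel :: ennreal measure)"
  let ?NY = "\<lambda>\<omega>. \<lambda>A\<in>sets borel. point_count Y \<omega> A" and ?NX = "\<lambda>\<omega>. \<lambda>A\<in>sets borel. point_count X \<omega> A"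
  interpret poisson_points M lamM X
    by unfold_locales (use intensity_pos users in auto)
  have indep: "indep_var ?N ?NY ?N ?NX"
    using indep_stations_users by (simp add: indep_point_processes_def)
  then have NY: "?NY \<in> measurable M ?N" and NX: "?NX \<in> measurable M ?N"
    by (auto dest: indep_var_rv1 indep_var_rv2)
  show ?thesis
  proof
    show "subalgebra M station_algebra"
      unfolding subalgebra_def station_algebra_def
      using NY by (auto simp: sets_vimage_algebra2 measurable_def)
    fix E and G :: "((real^2) set \<Rightarrow> ennreal) \<Rightarrow> ennreal"
    assume "E \<in> sets station_algebra" and G [measurable]: "G \<in> borel_measurable ?N"
    then obtain D where D [measurable]: "D \<in> sets ?N" and E: "E = ?NY -` D \<inter> space M"
      using measurable_space[OF NY] by (auto simp: station_algebra_def sets_vimage_algebra2)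
    have [measurable]: "E \<in> sets M" unfolding E using NY by (rule measurable_sets) simp
    have GX [measurable]: "(\<lambda>\<omega>. G (?NX \<omega>)) \<in> borel_measurable M"
      using NX by (rule measurable_compose) simp
    have "(\<integral>\<^sup>+\<omega>. indicator E \<omega> * G (?NX \<omega>) \<partial>M) = (\<integral>\<^sup>+\<omega>. indicator D (?NY \<omega>) * G (?NX \<omega>) \<partial>M)"
      by (intro nn_integral_cong) (auto simp: E split: split_indicator)
    also have "\<dots> = (\<integral>\<^sup>+\<omega>'. \<integral>\<^sup>+\<omega>. indicator D (?NY \<omega>') * G (?NX \<omega>) \<partial>M \<partial>M)"
      using nn_integral_indep_var[OF indep, of "\<lambda>(a, b). indicator D a * G b"] by simp
    also have "\<dots> = (\<integral>\<^sup>+\<omega>'. indicator E \<omega>' * (\<integral>\<^sup>+\<omega>. G (?NX \<omega>) \<partial>M) \<partial>M)"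
      by (intro nn_integral_cong) (simp add: nn_integral_cmult E split: split_indicator)
    also have "\<dots> = emeasure M E * (\<integral>\<^sup>+\<omega>. G (?NX \<omega>) \<partial>M)"
      by (simp add: nn_integral_multc)
    finally show "(\<integral>\<^sup>+\<omega>. indicator E \<omega> * G (?NX \<omega>) \<partial>M) = emeasure M E * (\<integral>\<^sup>+\<omega>. G (?NX \<omega>) \<partial>M)" .
  qed
qed

text \<open>
  A version of \<open>mean_user_capacity\<close> that is measurable with respect to \<open>station_algebra\<close>: the factor
  \<open>indicator\<close> is the one from \<open>measurable_point_sum\<close> and is almost surely 1.
\<close>

definition capacity_given_stations :: "(real \<Rightarrow> real) \<Rightarrow> real^2 \<Rightarrow> 'w \<Rightarrow> ennreal" where
  "capacity_given_stations f x \<omega> = (\<integral>\<^sup>+t. capacity_at f (path_loss_fading L t (0 - x)) *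
     (SUP n. expneg (indicator (locally_finite_on (space M) Y) \<omega> *
        (\<Sum>k. loss_tail_exponent n ((t, x), Y k \<omega>)))) \<partial>P\<^sub>H)"

lemma capacity_given_stations_measurable:
  assumes f: "f \<in> borel_measurable (restrict_space borel {0..})"
  shows "(\<lambda>(x, \<omega>). capacity_given_stations f x \<omega>) \<in> borel_measurable (borel \<Otimes>\<^sub>M station_algebra)"
proof -
  interpret P: prob_space P\<^sub>H by (rule prob_space_P\<^sub>H)
  have [measurable]: "L \<in> borel_measurable borel" by (rule path_loss_measurable)
  note [measurable] = measurable_capacity_at[OF f]
  define W where "W n = (\<lambda>(p, \<omega>). indicator (locally_finite_on (space M) Y) \<omega> *
        (\<Sum>k. loss_tail_exponent n (p, Y k \<omega>)))" for n
  have [measurable]: "W n \<in> borel_measurable ((borel \<Otimes>\<^sub>M borel) \<Otimes>\<^sub>M station_algebra)" for n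
    unfolding W_def
    using measurable_point_sum[OF station_counts_measurable loss_tail_exponent_measurable] by simp
  have "(\<lambda>(q, t). capacity_at f (path_loss_fading L t (0 - fst q)) * (SUP n. expneg (W n ((t, fst q), snd q))))
      \<in> borel_measurable ((borel \<Otimes>\<^sub>M station_algebra) \<Otimes>\<^sub>M P\<^sub>H)"
    by measurable
  from P.borel_measurable_nn_integral[OF this] show ?thesis
    by (simp add: capacity_given_stations_def W_def split_beta)
qed

lemma capacity_given_stations_AE:
  "AE \<omega> in M. \<forall>f x. mean_user_capacity f x (\<lambda>k. Y k \<omega>) = capacity_given_stations f x \<omega>"
proof -
  interpret poisson_points M lamB Y by (rule stations_poisson_points)
  have "AE \<omega> in M. point_count Y \<omega> (ball 0 (real n)) \<noteq> \<infinity>" for n :: nat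
    using count_mean[of "ball 0 (real n)"] emeasure_intensity_measure_bounded(2)[of "ball 0 (real n)" lamB] lam_pos
    by (intro nn_integral_PInf_AE) (auto simp: less_top)
  then have "AE \<omega> in M. \<forall>n::nat. point_count Y \<omega> (ball 0 (real n)) \<noteq> \<infinity>"
    by (simp add: AE_all_countable)
  with AE_space show ?thesis
  proof eventually_elim
    case (elim \<omega>)
    then have "indicator (locally_finite_on (space M) Y) \<omega> = (1 :: ennreal)"
      by (simp add: locally_finite_on_def less_top)
    then show ?case by (simp add: mean_user_capacity_def capacity_given_stations_def)
  qed
qed

text \<open>
  For fixed fading variables \<open>t\<close> and \<open>t'\<close> for the origin, this is the Harris inequality for
  increasing limits of functionals of product form; averaging over \<open>t\<close> and \<open>t'\<close> independently preserves
  the inequality, since the weights are nonnegative.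
\<close>

lemma mean_user_capacity_positively_correlated:
  assumes f: "f \<in> borel_measurable (restrict_space borel {0..})"
    and g: "g \<in> borel_measurable (restrict_space borel {0..})"
  shows "(\<integral>\<^sup>+\<omega>. mean_user_capacity f x (\<lambda>k. Y k \<omega>) \<partial>M) * (\<integral>\<^sup>+\<omega>. mean_user_capacity g x' (\<lambda>k. Y k \<omega>) \<partial>M)
    \<le> (\<integral>\<^sup>+\<omega>. mean_user_capacity f x (\<lambda>k. Y k \<omega>) * mean_user_capacity g x' (\<lambda>k. Y k \<omega>) \<partial>M)"
proof -
  interpret P: prob_space P\<^sub>H by (rule prob_space_P\<^sub>H)
  interpret MP: pair_sigma_finite M P\<^sub>H ..
  interpret S: poisson_points M lamB Y by (rule stations_poisson_points)
  have [measurable]: "L \<in> borel_measurable borel" by (rule path_loss_measurable)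
  note [measurable] = measurable_capacity_at[OF f] measurable_capacity_at[OF g] loss_tail_exponent_measurable
  define W where "W x n t \<omega> = expneg (\<Sum>k. loss_tail_exponent n ((t, x), Y k \<omega>))" for x n t \<omega>
  define V where "V x t \<omega> = (SUP n. W x n t \<omega>)" for x t \<omega>
  define a where "a t = capacity_at f (path_loss_fading L t (0 - x))" for t
  define b where "b t = capacity_at g (path_loss_fading L t (0 - x'))" for t
  have [measurable]: "a \<in> borel_measurable borel" "b \<in> borel_measurable borel"
    unfolding a_def b_def by measurable
  have W_meas: "(\<lambda>q. W x n (t q) (\<omega> q)) \<in> borel_measurable N"
    if [measurable]: "t \<in> borel_measurable N" "\<omega> \<in> measurable N M" for x n t \<omega> and N :: "'z measure"
    unfolding W_def by measurable
  have V_meas [measurable (raw)]: "(\<lambda>q. V x (t q) (\<omega> q)) \<in> borel_measurable N"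
    if "t \<in> borel_measurable N" "\<omega> \<in> measurable N M" for x t \<omega> and N :: "'z measure"
    unfolding V_def using W_meas[OF that] by measurable
  have inc: "incseq (\<lambda>n. W x n t)" for x t
    by (auto simp: incseq_def le_fun_def W_def intro!: expneg_antimono suminf_le loss_tail_exponent_antimono summableI)
  have mean_V: "(\<integral>\<^sup>+\<omega>. V x t \<omega> \<partial>M) = (SUP n. \<integral>\<^sup>+\<omega>. W x n t \<omega> \<partial>M)" for x t
    unfolding V_def by (rule nn_integral_monotone_convergence_SUP[OF inc]) (rule W_meas, auto)
  have corr: "(\<integral>\<^sup>+\<omega>. V x t \<omega> \<partial>M) * (\<integral>\<^sup>+\<omega>. V x' t' \<omega> \<partial>M) \<le> (\<integral>\<^sup>+\<omega>. V x t \<omega> * V x' t' \<omega> \<partial>M)" for t t'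
  proof -
    have "(\<integral>\<^sup>+\<omega>. W x n t \<omega> \<partial>M) * (\<integral>\<^sup>+\<omega>. W x' m t' \<omega> \<partial>M) \<le> (\<integral>\<^sup>+\<omega>. V x t \<omega> * V x' t' \<omega> \<partial>M)" for n m
    proof -
      have "(\<integral>\<^sup>+\<omega>. W x n t \<omega> \<partial>M) * (\<integral>\<^sup>+\<omega>. W x' m t' \<omega> \<partial>M) \<le> (\<integral>\<^sup>+\<omega>. W x n t \<omega> * W x' m t' \<omega> \<partial>M)"
        unfolding W_def
        by (rule expneg_point_sums_positively_correlated[OF S.points_measurable S.indep_counts]) measurable
      also have "\<dots> \<le> (\<integral>\<^sup>+\<omega>. V x t \<omega> * V x' t' \<omega> \<partial>M)"
        unfolding V_def by (intro nn_integral_mono mult_mono SUP_upper) auto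
      finally show ?thesis .
    qed
    then show ?thesis
      unfolding mean_V by (simp add: SUP_mult_left_ennreal SUP_mult_right_ennreal SUP_le_iff)
  qed
  have mean: "(\<integral>\<^sup>+\<omega>. (\<integral>\<^sup>+t. c t * V x t \<omega> \<partial>P\<^sub>H) \<partial>M) = (\<integral>\<^sup>+t. c t * (\<integral>\<^sup>+\<omega>. V x t \<omega> \<partial>M) \<partial>P\<^sub>H)"
    if [measurable]: "c \<in> borel_measurable borel" for c x
    by (subst MP.Fubini'[symmetric]) (simp_all add: nn_integral_cmult)
  have "(\<integral>\<^sup>+\<omega>. (\<integral>\<^sup>+t. a t * V x t \<omega> \<partial>P\<^sub>H) \<partial>M) * (\<integral>\<^sup>+\<omega>. (\<integral>\<^sup>+t'. b t' * V x' t' \<omega> \<partial>P\<^sub>H) \<partial>M)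
      = (\<integral>\<^sup>+t. a t * (\<integral>\<^sup>+\<omega>. V x t \<omega> \<partial>M) \<partial>P\<^sub>H) * (\<integral>\<^sup>+t'. b t' * (\<integral>\<^sup>+\<omega>. V x' t' \<omega> \<partial>M) \<partial>P\<^sub>H)"
    by (simp add: mean)
  also have "\<dots> = (\<integral>\<^sup>+t. \<integral>\<^sup>+t'. (a t * (\<integral>\<^sup>+\<omega>. V x t \<omega> \<partial>M)) * (b t' * (\<integral>\<^sup>+\<omega>. V x' t' \<omega> \<partial>M)) \<partial>P\<^sub>H \<partial>P\<^sub>H)"
    by (simp add: nn_integral_cmult nn_integral_multc)
  also have "\<dots> \<le> (\<integral>\<^sup>+t. \<integral>\<^sup>+t'. (\<integral>\<^sup>+\<omega>. (a t * V x t \<omega>) * (b t' * V x' t' \<omega>) \<partial>M) \<partial>P\<^sub>H \<partial>P\<^sub>H)"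
  proof (intro nn_integral_mono)
    fix t t'
    have "(a t * (\<integral>\<^sup>+\<omega>. V x t \<omega> \<partial>M)) * (b t' * (\<integral>\<^sup>+\<omega>. V x' t' \<omega> \<partial>M))
        = (a t * b t') * ((\<integral>\<^sup>+\<omega>. V x t \<omega> \<partial>M) * (\<integral>\<^sup>+\<omega>. V x' t' \<omega> \<partial>M))"
      by (simp add: mult_ac)
    also have "\<dots> \<le> (a t * b t') * (\<integral>\<^sup>+\<omega>. V x t \<omega> * V x' t' \<omega> \<partial>M)"
      by (intro mult_left_mono corr) auto
    also have "\<dots> = (\<integral>\<^sup>+\<omega>. (a t * V x t \<omega>) * (b t' * V x' t' \<omega>) \<partial>M)"
      by (subst nn_integral_cmult[symmetric]) (simp_all add: mult_ac)
    finally show "(a t * (\<integral>\<^sup>+\<omega>. V x t \<omega> \<partial>M)) * (b t' * (\<integral>\<^sup>+\<omega>. V x' t' \<omega> \<partial>M))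
        \<le> (\<integral>\<^sup>+\<omega>. (a t * V x t \<omega>) * (b t' * V x' t' \<omega>) \<partial>M)" .
  qed
  also have "\<dots> = (\<integral>\<^sup>+t. \<integral>\<^sup>+\<omega>. \<integral>\<^sup>+t'. (a t * V x t \<omega>) * (b t' * V x' t' \<omega>) \<partial>P\<^sub>H \<partial>M \<partial>P\<^sub>H)"
    by (intro nn_integral_cong MP.Fubini') simp
  also have "\<dots> = (\<integral>\<^sup>+\<omega>. \<integral>\<^sup>+t. \<integral>\<^sup>+t'. (a t * V x t \<omega>) * (b t' * V x' t' \<omega>) \<partial>P\<^sub>H \<partial>P\<^sub>H \<partial>M)"
    by (rule MP.Fubini') measurable
  also have "\<dots> = (\<integral>\<^sup>+\<omega>. (\<integral>\<^sup>+t. a t * V x t \<omega> \<partial>P\<^sub>H) * (\<integral>\<^sup>+t'. b t' * V x' t' \<omega> \<partial>P\<^sub>H) \<partial>M)"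
    by (intro nn_integral_cong) (simp add: nn_integral_cmult nn_integral_multc)
  finally show ?thesis
    unfolding mean_user_capacity_def a_def b_def V_def W_def .
qed

end

section \<open>Covariance of cell capacities\<close>

context cellular_network
begin

lemma user_capacity_at_measurable:
  assumes f: "f \<in> borel_measurable (restrict_space borel {0..})"
  shows "(\<lambda>\<omega>. user_capacity L f (X i \<omega>) (\<lambda>b. h b i \<omega>) (\<lambda>k. Y k \<omega>)) \<in> borel_measurable M"
  using path_loss_measurable fading_measurable by (intro measurable_user_capacity f) auto

lemma mean_capacity_eq_sum:
  assumes f: "f \<in> borel_measurable (restrict_space borel {0..})"
  shows "mean_capacity M Y X L h f
    = (\<Sum>i. \<integral>\<^sup>+\<omega>. user_capacity L f (X i \<omega>) (\<lambda>b. h b i \<omega>) (\<lambda>k. Y k \<omega>) \<partial>M)"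
  unfolding mean_capacity_def cell_capacity_eq
  by (rule nn_integral_suminf) (rule user_capacity_at_measurable[OF f])

lemma mean_capacity_eq_integral:
  assumes f: "f \<in> borel_measurable (restrict_space borel {0..})"
  shows "mean_capacity M Y X L h f
    = (\<integral>\<^sup>+x. \<integral>\<^sup>+\<omega>. mean_user_capacity f x (\<lambda>k. Y k \<omega>) \<partial>M \<partial>intensity_measure lamM)"
proof -
  interpret U: poisson_points_indep M lamM X station_algebra by (rule users_poisson_points_indep)
  have "(\<integral>\<^sup>+\<omega>. mean_user_capacity f (X i \<omega>) (\<lambda>k. Y k \<omega>) \<partial>M) = (\<integral>\<^sup>+\<omega>. capacity_given_stations f (X i \<omega>) \<omega> \<partial>M)" for i
    by (intro nn_integral_cong_AE AE_mp[OF capacity_given_stations_AE AE_I2]) simp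
  moreover have "(\<integral>\<^sup>+\<omega>. mean_user_capacity f x (\<lambda>k. Y k \<omega>) \<partial>M) = (\<integral>\<^sup>+\<omega>. capacity_given_stations f x \<omega> \<partial>M)" for x
    by (intro nn_integral_cong_AE AE_mp[OF capacity_given_stations_AE AE_I2]) simp
  ultimately show ?thesis
    using U.campbell[OF capacity_given_stations_measurable[OF f]]
    by (simp add: mean_capacity_eq_sum[OF f] nn_integral_capacity_at_user[OF f])
qed

lemma user_capacity_mult:
  assumes "\<And>t. t \<ge> 0 \<Longrightarrow> f t \<ge> 0"
  shows "user_capacity L f x e y * user_capacity L g x e y = user_capacity L (\<lambda>t. f t * g t) x e y"
  using assms by (simp add: user_capacity_def ennreal_mult')

text \<open>
  The covariance inequality in additive form. The only inequality in its proof is the positive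
  correlation for a pair of fixed locations; the diagonal and the pair integrals are computed exactly.
\<close>

lemma mean_capacity_product:
  assumes f: "f \<in> borel_measurable (restrict_space borel {0..})" and nonneg: "\<And>t. t \<ge> 0 \<Longrightarrow> f t \<ge> 0"
    and g: "g \<in> borel_measurable (restrict_space borel {0..})"
  shows "mean_capacity M Y X L h (\<lambda>t. f t * g t) + mean_capacity M Y X L h f * mean_capacity M Y X L h g
    \<le> (\<integral>\<^sup>+\<omega>. cell_capacity Y X L h f \<omega> * cell_capacity Y X L h g \<omega> \<partial>M)"
proof -
  interpret U: poisson_points_indep M lamM X station_algebra by (rule users_poisson_points_indep)
  interpret \<Lambda>: sigma_finite_measure "intensity_measure lamM" by (rule sigma_finite_intensity_measure)
  define F where "F i \<omega> = user_capacity L f (X i \<omega>) (\<lambda>b. h b i \<omega>) (\<lambda>k. Y k \<omega>)" for i \<omega>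
  define G where "G i \<omega> = user_capacity L g (X i \<omega>) (\<lambda>b. h b i \<omega>) (\<lambda>k. Y k \<omega>)" for i \<omega>
  have [measurable]: "F i \<in> borel_measurable M" "G i \<in> borel_measurable M" for i
    unfolding F_def G_def by (rule user_capacity_at_measurable[OF f] user_capacity_at_measurable[OF g])+
  have fg: "(\<lambda>t. f t * g t) \<in> borel_measurable (restrict_space borel {0..})"
    using f g by simp
  have f_meas [measurable]: "(\<lambda>(x, \<omega>). capacity_given_stations f x \<omega>) \<in> borel_measurable (borel \<Otimes>\<^sub>M station_algebra)"
    and g_meas [measurable]: "(\<lambda>(x, \<omega>). capacity_given_stations g x \<omega>) \<in> borel_measurable (borel \<Otimes>\<^sub>M station_algebra)"
    by (rule capacity_given_stations_measurable f g)+
  have "(\<integral>\<^sup>+\<omega>. cell_capacity Y X L h f \<omega> * cell_capacity Y X L h g \<omega> \<partial>M)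
      = (\<integral>\<^sup>+\<omega>. (\<Sum>i. \<Sum>j. F i \<omega> * G j \<omega>) \<partial>M)"
    by (simp only: cell_capacity_eq F_def G_def ennreal_suminf_cmult ennreal_suminf_multc)
  also have "\<dots> = (\<Sum>i. \<Sum>j. \<integral>\<^sup>+\<omega>. F i \<omega> * G j \<omega> \<partial>M)"
    by (subst nn_integral_suminf, simp)+ (rule refl)
  also have "\<dots> = (\<integral>\<^sup>+p. \<integral>\<^sup>+\<omega>. F (fst p) \<omega> * G (snd p) \<omega> \<partial>M \<partial>count_space {(i, j). i \<noteq> j})
      + (\<Sum>i. \<integral>\<^sup>+\<omega>. F i \<omega> * G i \<omega> \<partial>M)"
    by (rule suminf_suminf_off_diagonal)
  also have "(\<Sum>i. \<integral>\<^sup>+\<omega>. F i \<omega> * G i \<omega> \<partial>M) = mean_capacity M Y X L h (\<lambda>t. f t * g t)"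
    by (simp add: F_def G_def user_capacity_mult nonneg mean_capacity_eq_sum[OF fg])
  also have "(\<integral>\<^sup>+p. \<integral>\<^sup>+\<omega>. F (fst p) \<omega> * G (snd p) \<omega> \<partial>M \<partial>count_space {(i, j). i \<noteq> j})
      = (\<integral>\<^sup>+p. \<integral>\<^sup>+\<omega>. capacity_given_stations f (X (fst p) \<omega>) \<omega> * capacity_given_stations g (X (snd p) \<omega>) \<omega> \<partial>M \<partial>count_space {(i, j). i \<noteq> j})"
  proof (rule nn_integral_cong)
    fix p :: "nat \<times> nat" assume "p \<in> space (count_space {(i, j). i \<noteq> j})"
    then have "fst p \<noteq> snd p" by auto
    then have "(\<integral>\<^sup>+\<omega>. F (fst p) \<omega> * G (snd p) \<omega> \<partial>M)
        = (\<integral>\<^sup>+\<omega>. mean_user_capacity f (X (fst p) \<omega>) (\<lambda>k. Y k \<omega>) * mean_user_capacity g (X (snd p) \<omega>) (\<lambda>k. Y k \<omega>) \<partial>M)"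
      unfolding F_def G_def by (rule nn_integral_capacity_at_two_users[OF f g])
    also have "\<dots> = (\<integral>\<^sup>+\<omega>. capacity_given_stations f (X (fst p) \<omega>) \<omega> * capacity_given_stations g (X (snd p) \<omega>) \<omega> \<partial>M)"
      by (intro nn_integral_cong_AE AE_mp[OF capacity_given_stations_AE AE_I2]) simp
    finally show "(\<integral>\<^sup>+\<omega>. F (fst p) \<omega> * G (snd p) \<omega> \<partial>M)
        = (\<integral>\<^sup>+\<omega>. capacity_given_stations f (X (fst p) \<omega>) \<omega> * capacity_given_stations g (X (snd p) \<omega>) \<omega> \<partial>M)" .
  qed
  also have "\<dots> = (\<integral>\<^sup>+x. \<integral>\<^sup>+x'. \<integral>\<^sup>+\<omega>. capacity_given_stations f x \<omega> * capacity_given_stations g x' \<omega> \<partial>M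
      \<partial>intensity_measure lamM \<partial>intensity_measure lamM)"
  proof -
    have "(\<lambda>(z, \<omega>). (case (fst z, \<omega>) of (x, \<omega>) \<Rightarrow> capacity_given_stations f x \<omega>) * (case (snd z, \<omega>) of (x, \<omega>) \<Rightarrow> capacity_given_stations g x \<omega>))
        \<in> borel_measurable ((borel \<Otimes>\<^sub>M borel) \<Otimes>\<^sub>M station_algebra)"
      by measurable
    from U.campbell_off_diagonal[OF this] show ?thesis by simp
  qed
  also have "\<dots> = (\<integral>\<^sup>+x. \<integral>\<^sup>+x'. \<integral>\<^sup>+\<omega>. mean_user_capacity f x (\<lambda>k. Y k \<omega>) * mean_user_capacity g x' (\<lambda>k. Y k \<omega>) \<partial>M
      \<partial>intensity_measure lamM \<partial>intensity_measure lamM)"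
    by (intro nn_integral_cong nn_integral_cong_AE AE_mp[OF capacity_given_stations_AE AE_I2]) simp
  finally have "(\<integral>\<^sup>+\<omega>. cell_capacity Y X L h f \<omega> * cell_capacity Y X L h g \<omega> \<partial>M)
      = (\<integral>\<^sup>+x. \<integral>\<^sup>+x'. \<integral>\<^sup>+\<omega>. mean_user_capacity f x (\<lambda>k. Y k \<omega>) * mean_user_capacity g x' (\<lambda>k. Y k \<omega>) \<partial>M
      \<partial>intensity_measure lamM \<partial>intensity_measure lamM) + mean_capacity M Y X L h (\<lambda>t. f t * g t)" .
  moreover have "mean_capacity M Y X L h f * mean_capacity M Y X L h g
    \<le> (\<integral>\<^sup>+x. \<integral>\<^sup>+x'. \<integral>\<^sup>+\<omega>. mean_user_capacity f x (\<lambda>k. Y k \<omega>) * mean_user_capacity g x' (\<lambda>k. Y k \<omega>) \<partial>M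
      \<partial>intensity_measure lamM \<partial>intensity_measure lamM)"
  proof -
    have mean_meas: "(\<lambda>x. \<integral>\<^sup>+\<omega>. mean_user_capacity c x (\<lambda>k. Y k \<omega>) \<partial>M) \<in> borel_measurable (intensity_measure lamM)"
      if c: "c \<in> borel_measurable (restrict_space borel {0..})" for c
    proof -
      have "(\<lambda>(x, \<omega>). capacity_given_stations c x \<omega>) \<in> borel_measurable (borel \<Otimes>\<^sub>M M)"
        by (rule U.subalg_measurable_pair[OF capacity_given_stations_measurable[OF c]])
      then have "(\<lambda>x. \<integral>\<^sup>+\<omega>. capacity_given_stations c x \<omega> \<partial>M) \<in> borel_measurable borel"
        by (rule borel_measurable_nn_integral)
      also have "(\<lambda>x. \<integral>\<^sup>+\<omega>. capacity_given_stations c x \<omega> \<partial>M) = (\<lambda>x. \<integral>\<^sup>+\<omega>. mean_user_capacity c x (\<lambda>k. Y k \<omega>) \<partial>M)"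
        by (intro ext nn_integral_cong_AE AE_mp[OF capacity_given_stations_AE AE_I2]) simp
      finally show ?thesis by (simp cong: measurable_cong_sets)
    qed
    have "mean_capacity M Y X L h f * mean_capacity M Y X L h g
      = (\<integral>\<^sup>+x. \<integral>\<^sup>+x'. (\<integral>\<^sup>+\<omega>. mean_user_capacity f x (\<lambda>k. Y k \<omega>) \<partial>M) * (\<integral>\<^sup>+\<omega>. mean_user_capacity g x' (\<lambda>k. Y k \<omega>) \<partial>M)
      \<partial>intensity_measure lamM \<partial>intensity_measure lamM)"
      by (simp add: mean_capacity_eq_integral f g nn_integral_cmult nn_integral_multc mean_meas)
    also have "\<dots> \<le> (\<integral>\<^sup>+x. \<integral>\<^sup>+x'. \<integral>\<^sup>+\<omega>. mean_user_capacity f x (\<lambda>k. Y k \<omega>) * mean_user_capacity g x' (\<lambda>k. Y k \<omega>) \<partial>M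
      \<partial>intensity_measure lamM \<partial>intensity_measure lamM)"
      by (intro nn_integral_mono mean_user_capacity_positively_correlated f g)
    finally show ?thesis .
  qed
  ultimately show ?thesis by (simp add: add.commute add_left_mono)
qed

lemma ext_cov_cell_capacity_ge:
  assumes f: "f \<in> borel_measurable (restrict_space borel {0..})" and nonneg: "\<And>t. t \<ge> 0 \<Longrightarrow> f t \<ge> 0"
    and g: "g \<in> borel_measurable (restrict_space borel {0..})"
    and fin: "mean_capacity M Y X L h f < \<infinity>" "mean_capacity M Y X L h g < \<infinity>"
  shows "ext_cov M (cell_capacity Y X L h f) (cell_capacity Y X L h g)
    \<ge> enn2ereal (mean_capacity M Y X L h (\<lambda>t. f t * g t))"
proof -
  let ?m = "mean_capacity M Y X L h"
  obtain a b where ab: "?m f = ennreal a" "a \<ge> 0" "?m g = ennreal b" "b \<ge> 0"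
    using fin by (cases "?m f"; cases "?m g") auto
  have "enn2ereal (?m (\<lambda>t. f t * g t)) + enn2ereal (?m f) * enn2ereal (?m g)
      \<le> enn2ereal (\<integral>\<^sup>+\<omega>. cell_capacity Y X L h f \<omega> * cell_capacity Y X L h g \<omega> \<partial>M)"
    using mean_capacity_product[OF f nonneg g]
    by (simp add: less_eq_ennreal.rep_eq plus_ennreal.rep_eq times_ennreal.rep_eq)
  then have "enn2ereal (?m (\<lambda>t. f t * g t)) + ereal (a * b)
      \<le> enn2ereal (\<integral>\<^sup>+\<omega>. cell_capacity Y X L h f \<omega> * cell_capacity Y X L h g \<omega> \<partial>M)"
    using ab by (simp add: enn2ereal_ennreal)
  then have "enn2ereal (?m (\<lambda>t. f t * g t))
      \<le> enn2ereal (\<integral>\<^sup>+\<omega>. cell_capacity Y X L h f \<omega> * cell_capacity Y X L h g \<omega> \<partial>M) - ereal (a * b)"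
    by (simp add: ereal_le_minus)
  then show ?thesis
    unfolding ext_cov_def using ab by (simp add: mean_capacity_def[symmetric] enn2ereal_ennreal)
qed

end

theorem theorem6:
  fixes M :: "'w measure"
    and lamB lamM :: real
    and Y X :: "nat \<Rightarrow> 'w \<Rightarrow> real^2"
    and L :: "real^2 \<Rightarrow> real"
    and H :: "'w \<Rightarrow> real" and p\<^sub>H :: "real \<Rightarrow> real"
    and h :: "nat option \<Rightarrow> nat \<Rightarrow> 'w \<Rightarrow> real"
    and f g :: "real \<Rightarrow> real"
  assumes "cellular_network M lamB lamM Y X L H p\<^sub>H h"
    and "f \<in> borel_measurable (restrict_space borel {0..})" and "\<And>t. t \<ge> 0 \<Longrightarrow> f t \<ge> 0"
    and "g \<in> borel_measurable (restrict_space borel {0..})" and "\<And>t. t \<ge> 0 \<Longrightarrow> g t \<ge> 0"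
    and "mean_capacity M Y X L h f < \<infinity>"
    and "mean_capacity M Y X L h g < \<infinity>"
  shows "ext_cov M (cell_capacity Y X L h f) (cell_capacity Y X L h g)
           \<ge> enn2ereal (mean_capacity M Y X L h (\<lambda>t. f t * g t))
       \<and> ext_var M (cell_capacity Y X L h f)
           \<ge> enn2ereal (mean_capacity M Y X L h (\<lambda>t. (f t)\<^sup>2))"
proof -
  interpret cellular_network M lamB lamM Y X L H p\<^sub>H h by fact
  show ?thesis
    using ext_cov_cell_capacity_ge[OF assms(2,3,4,6,7)] ext_cov_cell_capacity_ge[OF assms(2,3,2,6,6)]
    by (simp add: ext_var_def power2_eq_square)
qed

end
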